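(* Let $(M^n,g)$ be a Riemannian spin manifold with a metric connection $\nabla$ with skew-symmetric torsion $\mathrm{T}$ such that $\nabla\mathrm{T}=0$. Then the Casimir operator $\Omega$ of $(M^n,g,\nabla)$ and the square $(D^{1/3})^2$ of the Dirac operator $D^{1/3}$ commute with the endomorphism $\mathrm{T}$ of the spinor bundle (Clifford multiplication by $\mathrm{T}$): $$\Omega\circ\mathrm{T}=\mathrm{T}\circ\Omega,\qquad (D^{1/3})^2\circ\mathrm{T}=\mathrm{T}\circ(D^{1/3})^2.$$
   Context: Clifford multiplication satisfies $X\cdot X=-g(X,X)$; $S$ is the complex spinor bundle, and a form acts on spinors by Clifford multiplication, where $e_{i_1}\wedge\dots\wedge e_{i_p}$ acts as $e_{i_1}\cdots e_{i_p}$ for an orthonormal frame $e_1,\dots,e_n$. A metric connection with skew-symmetric torsion given by the $3$-form $\mathrm{T}$ is $\nabla_XY=\nabla^g_XY+\tfrac12\mathrm{T}(X,Y,-)$ ($\nabla^g$ is the Levi-Civita connection and the $1$-form $\mathrm{T}(X,Y,-)$ is identified with a vector via $g$); it lifts to spinors as $\nabla_X\psi=\nabla^g_X\psi+\tfrac14(X\lrcorner\mathrm{T})\cdot\psi$. Let $D^g$ be the Riemannian Dirac operator and $D^{1/3}=D^g+\tfrac14\mathrm{T}$ (the Dirac operator of the connection with torsion $\mathrm{T}/3$). Put $\sigma_{\mathrm{T}}=\tfrac12\sum_k(e_k\lrcorner\mathrm{T})\wedge(e_k\lrcorner\mathrm{T})$, $\|\mathrm{T}\|^2=\sum_{i<j<k}\mathrm{T}(e_i,e_j,e_k)^2$,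 $\delta(\mathrm{T})=-\sum_k e_k\lrcorner\nabla^g_{e_k}\mathrm{T}$, let $\mathrm{Scal}^g$ be the Riemannian scalar curvature, $\mathrm{Scal}=\mathrm{Scal}^g-\tfrac32\|\mathrm{T}\|^2$ the scalar curvature of $\nabla$, and $\Delta_{\mathrm{T}}=\nabla^*\nabla$ the spinor Laplacian of $\nabla$. The Casimir operator of $(M^n,g,\nabla)$ is the operator on spinor fields $$\Omega=(D^{1/3})^2+\tfrac18(d\mathrm{T}-2\sigma_{\mathrm{T}})+\tfrac14\delta(\mathrm{T})-\tfrac18\mathrm{Scal}^g-\tfrac1{16}\|\mathrm{T}\|^2=\Delta_{\mathrm{T}}+\tfrac18\big(3\,d\mathrm{T}-2\sigma_{\mathrm{T}}+2\,\delta(\mathrm{T})+\mathrm{Scal}\big).$$ *)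

theory Defs
  imports "HOL-Analysis.Analysis"
begin

subsection \<open>Smooth functions, tangent vectors and vector fields\<close>

text \<open>These notions are meant for open \<open>S\<close>.\<close>

primrec Ck_on ::
  "nat \<Rightarrow> 'a::real_normed_vector set \<Rightarrow> ('a \<Rightarrow> 'b::real_normed_vector) \<Rightarrow> bool" where
  "Ck_on 0 S f \<longleftrightarrow> continuous_on S f"
| "Ck_on (Suc k) S f \<longleftrightarrow>
     (\<forall>x\<in>S. f differentiable (at x)) \<and> (\<forall>v. Ck_on k S (\<lambda>x. frechet_derivative f (at x) v))"

definition Cinf_on ::
  "'a::real_normed_vector set \<Rightarrow> ('a \<Rightarrow> 'b::real_normed_vector) \<Rightarrow> bool" where
  "Cinf_on S f \<longleftrightarrow> (\<forall>k. Ck_on k S f)"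

type_synonym ('m, 'n) atlas = "('m set \<times> ('m \<Rightarrow> real ^ 'n)) set"

text \<open>The manifold is the whole type \<open>'m\<close>, of dimension \<open>CARD('n)\<close>; a chart is a pair of an open
  set and a map that is only relevant on this set. In the main theorem \<open>'m\<close> is Hausdorff and
  second countable.\<close>

definition smooth_atlas :: "('m::topological_space, 'n::finite) atlas \<Rightarrow> bool" where
  "smooth_atlas A \<longleftrightarrow>
     (\<Union>(U, \<phi>)\<in>A. U) = UNIV \<and>
     (\<forall>(U, \<phi>)\<in>A. open U \<and> open (\<phi> ` U) \<and> homeomorphism U (\<phi> ` U) \<phi> (inv_into U \<phi>)) \<and>
     (\<forall>(U, \<phi>)\<in>A. \<forall>(V, \<eta>)\<in>A. Cinf_on (\<phi> ` (U \<inter> V)) (\<eta> \<circ> inv_into U \<phi>))"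

text \<open>\<open>smooth_at A p f\<close>: the function \<open>f\<close> is smooth on some neighbourhood of \<open>p\<close>.\<close>

definition smooth_at ::
  "('m::topological_space, 'n::finite) atlas \<Rightarrow> 'm \<Rightarrow> ('m \<Rightarrow> real) \<Rightarrow> bool" where
  "smooth_at A p f \<longleftrightarrow>
     (\<exists>N. open N \<and> p \<in> N \<and> (\<forall>(U, \<phi>)\<in>A. Cinf_on (\<phi> ` (N \<inter> U)) (f \<circ> inv_into U \<phi>)))"

text \<open>A tangent vector at \<open>p\<close> is a derivation at \<open>p\<close> of the functions that are smooth near \<open>p\<close>. Its
  value on all other functions is fixed to be \<open>0\<close>, so that two tangent vectors are equal iff they
  are the same derivation. That a derivation only depends on germs is automatic, as the indicator
  functions used to cut off are smooth near \<open>p\<close>.\<close>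

type_synonym 'm tvec = "('m \<Rightarrow> real) \<Rightarrow> real"
type_synonym 'm vfield = "'m \<Rightarrow> 'm tvec"

definition tangent_space ::
  "('m::topological_space, 'n::finite) atlas \<Rightarrow> 'm \<Rightarrow> 'm tvec set" where
  "tangent_space A p = {v.
     (\<forall>f. \<not> smooth_at A p f \<longrightarrow> v f = 0) \<and>
     (\<forall>f h. smooth_at A p f \<longrightarrow> smooth_at A p h \<longrightarrow> v (\<lambda>x. f x + h x) = v f + v h) \<and>
     (\<forall>c f. smooth_at A p f \<longrightarrow> v (\<lambda>x. c * f x) = c * v f) \<and>
     (\<forall>f h. smooth_at A p f \<longrightarrow> smooth_at A p h \<longrightarrow>
        v (\<lambda>x. f x * h x) = f p * v h + h p * v f)}"

definition vector_field_on ::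
  "('m::topological_space, 'n::finite) atlas \<Rightarrow> 'm set \<Rightarrow> 'm vfield \<Rightarrow> bool" where
  "vector_field_on A U X \<longleftrightarrow>
     (\<forall>q\<in>U. X q \<in> tangent_space A q \<and> (\<forall>f. smooth_at A q f \<longrightarrow> smooth_at A q (\<lambda>x. X x f)))"

text \<open>\<open>vector_field_at A p X\<close>: \<open>X\<close> is a smooth vector field on some neighbourhood of \<open>p\<close>.\<close>

definition vector_field_at ::
  "('m::topological_space, 'n::finite) atlas \<Rightarrow> 'm \<Rightarrow> 'm vfield \<Rightarrow> bool" where
  "vector_field_at A p X \<longleftrightarrow> (\<exists>N. open N \<and> p \<in> N \<and> vector_field_on A N X)"

definition lie_bracket ::
  "('m::topological_space, 'n::finite) atlas \<Rightarrow> 'm vfield \<Rightarrow> 'm vfield \<Rightarrow> 'm vfield" where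
  "lie_bracket A X Y p f =
     (if smooth_at A p f then X p (\<lambda>q. Y q f) - Y p (\<lambda>q. X q f) else 0)"


subsection \<open>Riemannian metrics, \<open>3\<close>-forms and connections\<close>

type_synonym 'm bilin = "'m \<Rightarrow> 'm tvec \<Rightarrow> 'm tvec \<Rightarrow> real"
type_synonym 'm trilin = "'m \<Rightarrow> 'm tvec \<Rightarrow> 'm tvec \<Rightarrow> 'm tvec \<Rightarrow> real"

definition riemannian_metric ::
  "('m::topological_space, 'n::finite) atlas \<Rightarrow> 'm bilin \<Rightarrow> bool" where
  "riemannian_metric A g \<longleftrightarrow>
     (\<forall>p. \<forall>u\<in>tangent_space A p. \<forall>v\<in>tangent_space A p. \<forall>w\<in>tangent_space A p. \<forall>a b.
        g p (\<lambda>f. a * u f + b * v f) w = a * g p u w + b * g p v w) \<and>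
     (\<forall>p. \<forall>u\<in>tangent_space A p. \<forall>v\<in>tangent_space A p. g p u v = g p v u) \<and>
     (\<forall>p. \<forall>u\<in>tangent_space A p. u \<noteq> (\<lambda>f. 0) \<longrightarrow> g p u u > 0) \<and>
     (\<forall>p X Y. vector_field_at A p X \<longrightarrow> vector_field_at A p Y \<longrightarrow>
        smooth_at A p (\<lambda>q. g q (X q) (Y q)))"

definition three_form ::
  "('m::topological_space, 'n::finite) atlas \<Rightarrow> 'm trilin \<Rightarrow> bool" where
  "three_form A T \<longleftrightarrow>
     (\<forall>p. \<forall>u\<in>tangent_space A p. \<forall>v\<in>tangent_space A p. \<forall>w\<in>tangent_space A p.
        \<forall>z\<in>tangent_space A p. \<forall>a b.
        T p (\<lambda>f. a * u f + b * v f) w z = a * T p u w z + b * T p v w z) \<and>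
     (\<forall>p. \<forall>u\<in>tangent_space A p. \<forall>v\<in>tangent_space A p. \<forall>w\<in>tangent_space A p.
        T p v u w = - T p u v w \<and> T p u w v = - T p u v w) \<and>
     (\<forall>p X Y Z. vector_field_at A p X \<longrightarrow> vector_field_at A p Y \<longrightarrow> vector_field_at A p Z \<longrightarrow>
        smooth_at A p (\<lambda>q. T q (X q) (Y q) (Z q)))"

text \<open>Connections act on vector fields defined near a point.\<close>

type_synonym 'm connection = "'m vfield \<Rightarrow> 'm vfield \<Rightarrow> 'm vfield"

definition affine_connection ::
  "('m::topological_space, 'n::finite) atlas \<Rightarrow> 'm connection \<Rightarrow> bool" where
  "affine_connection A D \<longleftrightarrow>
     (\<forall>p X Y Z f. vector_field_at A p X \<longrightarrow> vector_field_at A p Y \<longrightarrow> vector_field_at A p Z \<longrightarrow>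
        smooth_at A p f \<longrightarrow>
        vector_field_at A p (D X Y) \<and>
        D (\<lambda>q h. X q h + Y q h) Z p = (\<lambda>h. D X Z p h + D Y Z p h) \<and>
        D (\<lambda>q h. f q * X q h) Z p = (\<lambda>h. f p * D X Z p h) \<and>
        D X (\<lambda>q h. Y q h + Z q h) p = (\<lambda>h. D X Y p h + D X Z p h) \<and>
        D X (\<lambda>q h. f q * Y q h) p = (\<lambda>h. X p f * Y p h + f p * D X Y p h))"

definition levi_civita ::
  "('m::topological_space, 'n::finite) atlas \<Rightarrow> 'm bilin \<Rightarrow> 'm connection \<Rightarrow> bool" where
  "levi_civita A g D \<longleftrightarrow>
     affine_connection A D \<and>
     (\<forall>p X Y Z. vector_field_at A p X \<longrightarrow> vector_field_at A p Y \<longrightarrow> vector_field_at A p Z \<longrightarrow>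
        X p (\<lambda>q. g q (Y q) (Z q)) = g p (D X Y p) (Z p) + g p (Y p) (D X Z p)) \<and>
     (\<forall>p X Y. vector_field_at A p X \<longrightarrow> vector_field_at A p Y \<longrightarrow>
        (\<lambda>f. D X Y p f - D Y X p f) = lie_bracket A X Y p)"

text \<open>The vector identified with a \<open>1\<close>-form via the metric.\<close>

definition sharp ::
  "('m::topological_space, 'n::finite) atlas \<Rightarrow> 'm bilin \<Rightarrow> 'm \<Rightarrow> ('m tvec \<Rightarrow> real) \<Rightarrow> 'm tvec" where
  "sharp A g p \<alpha> = (THE v. v \<in> tangent_space A p \<and> (\<forall>w\<in>tangent_space A p. g p v w = \<alpha> w))"

definition torsion_connection ::
  "('m::topological_space, 'n::finite) atlas \<Rightarrow> 'm bilin \<Rightarrow> 'm connection \<Rightarrow> 'm trilin \<Rightarrow>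
     'm connection" where
  "torsion_connection A g LC T X Y p =
     (\<lambda>f. LC X Y p f + 1 / 2 * sharp A g p (T p (X p) (Y p)) f)"

text \<open>\<open>cov_deriv D T X Y Z W p\<close> is \<open>(D\<^sub>X T)(Y, Z, W)\<close> at \<open>p\<close>.\<close>

definition cov_deriv ::
  "'m connection \<Rightarrow> 'm trilin \<Rightarrow> 'm vfield \<Rightarrow> 'm vfield \<Rightarrow> 'm vfield \<Rightarrow> 'm vfield \<Rightarrow> 'm \<Rightarrow> real" where
  "cov_deriv D T X Y Z W p =
     X p (\<lambda>q. T q (Y q) (Z q) (W q))
     - T p (D X Y p) (Z p) (W p) - T p (Y p) (D X Z p) (W p) - T p (Y p) (Z p) (D X W p)"

definition parallel_form ::
  "('m::topological_space, 'n::finite) atlas \<Rightarrow> 'm connection \<Rightarrow> 'm trilin \<Rightarrow> bool" where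
  "parallel_form A D T \<longleftrightarrow>
     (\<forall>p X Y Z W. vector_field_at A p X \<longrightarrow> vector_field_at A p Y \<longrightarrow> vector_field_at A p Z \<longrightarrow>
        vector_field_at A p W \<longrightarrow> cov_deriv D T X Y Z W p = 0)"

text \<open>The exterior derivative \<open>dT(X, Y, Z, W)\<close> of a \<open>3\<close>-form.\<close>

definition ext_deriv ::
  "('m::topological_space, 'n::finite) atlas \<Rightarrow> 'm trilin \<Rightarrow>
     'm vfield \<Rightarrow> 'm vfield \<Rightarrow> 'm vfield \<Rightarrow> 'm vfield \<Rightarrow> 'm \<Rightarrow> real" where
  "ext_deriv A T X Y Z W p =
     X p (\<lambda>q. T q (Y q) (Z q) (W q)) - Y p (\<lambda>q. T q (X q) (Z q) (W q))
     + Z p (\<lambda>q. T q (X q) (Y q) (W q)) - W p (\<lambda>q. T q (X q) (Y q) (Z q))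
     - T p (lie_bracket A X Y p) (Z p) (W p) + T p (lie_bracket A X Z p) (Y p) (W p)
     - T p (lie_bracket A X W p) (Y p) (Z p) - T p (lie_bracket A Y Z p) (X p) (W p)
     + T p (lie_bracket A Y W p) (X p) (Z p) - T p (lie_bracket A Z W p) (X p) (Y p)"

text \<open>The wedge product of two \<open>2\<close>-forms at a point, as a sum over the \<open>(2, 2)\<close>-shuffles.\<close>

definition wedge2 ::
  "('m tvec \<Rightarrow> 'm tvec \<Rightarrow> real) \<Rightarrow> ('m tvec \<Rightarrow> 'm tvec \<Rightarrow> real) \<Rightarrow>
     'm tvec \<Rightarrow> 'm tvec \<Rightarrow> 'm tvec \<Rightarrow> 'm tvec \<Rightarrow> real" where
  "wedge2 \<alpha> \<beta> x y z w =
     \<alpha> x y * \<beta> z w - \<alpha> x z * \<beta> y w + \<alpha> x w * \<beta> y z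
     + \<alpha> y z * \<beta> x w - \<alpha> y w * \<beta> x z + \<alpha> z w * \<beta> x y"

definition curvature ::
  "('m::topological_space, 'n::finite) atlas \<Rightarrow> 'm connection \<Rightarrow>
     'm vfield \<Rightarrow> 'm vfield \<Rightarrow> 'm vfield \<Rightarrow> 'm vfield" where
  "curvature A D X Y Z p =
     (\<lambda>f. D X (D Y Z) p f - D Y (D X Z) p f - D (lie_bracket A X Y) Z p f)"


subsection \<open>Clifford matrices and the spin group\<close>

text \<open>The spinor module is \<open>\<complex>\<^bsup>2^\<lfloor>n/2\<rfloor>\<^esup>\<close>, so it is an irreducible module of the complex Clifford
  algebra of Euclidean \<open>n\<close>-space with \<open>x \<cdot> x = - \<bar>x\<bar>\<^sup>2\<close>. For odd \<open>n\<close> there are two such modules;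
  either may be used, as they restrict to the same representation of the spin group.\<close>

definition clifford_matrices :: "('n::finite \<Rightarrow> complex ^ 's ^ 's::finite) \<Rightarrow> bool" where
  "clifford_matrices \<gamma> \<longleftrightarrow>
     (\<forall>i j. \<gamma> i ** \<gamma> j + \<gamma> j ** \<gamma> i = mat (if i = j then - 2 else 0)) \<and>
     CARD('s) = 2 ^ (CARD('n) div 2)"

text \<open>\<open>Spin(n)\<close>, the group of products of an even number of unit vectors in the Clifford algebra, is
  identified with its image under the spin representation. This loses nothing: for even \<open>n\<close> the
  spinor module is a faithful module of the complex Clifford algebra, and for odd \<open>n\<close> a faithful
  module of its even part.\<close>

inductive_set spin_group :: "('n::finite \<Rightarrow> complex ^ 's ^ 's::finite) \<Rightarrow> (complex ^ 's ^ 's) set"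
  for \<gamma> where
  one: "mat 1 \<in> spin_group \<gamma>"
| mult: "h \<in> spin_group \<gamma> \<Longrightarrow> norm (u :: real ^ 'n) = 1 \<Longrightarrow> norm (v :: real ^ 'n) = 1 \<Longrightarrow>
    (\<Sum>i\<in>UNIV. u $ i *\<^sub>R \<gamma> i) ** (\<Sum>i\<in>UNIV. v $ i *\<^sub>R \<gamma> i) ** h \<in> spin_group \<gamma>"

text \<open>Clifford multiplication by forms with components \<open>c\<close>; the form
  \<open>\<Sum>\<^bsub>i<j<k\<^esub> c\<^bsub>ijk\<^esub> e\<^sub>i \<and> e\<^sub>j \<and> e\<^sub>k\<close> acts as \<open>\<Sum>\<^bsub>i<j<k\<^esub> c\<^bsub>ijk\<^esub> \<gamma>\<^sub>i \<gamma>\<^sub>j \<gamma>\<^sub>k\<close>.\<close>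

definition cl2 ::
  "('n::{finite, linorder} \<Rightarrow> complex ^ 's ^ 's::finite) \<Rightarrow> ('n \<Rightarrow> 'n \<Rightarrow> real) \<Rightarrow> complex ^ 's ^ 's" where
  "cl2 \<gamma> c = (\<Sum>(i, j) | i < j. c i j *\<^sub>R (\<gamma> i ** \<gamma> j))"

definition cl3 ::
  "('n::{finite, linorder} \<Rightarrow> complex ^ 's ^ 's::finite) \<Rightarrow> ('n \<Rightarrow> 'n \<Rightarrow> 'n \<Rightarrow> real) \<Rightarrow>
     complex ^ 's ^ 's" where
  "cl3 \<gamma> c = (\<Sum>(i, j, k) | i < j \<and> j < k. c i j k *\<^sub>R (\<gamma> i ** \<gamma> j ** \<gamma> k))"

definition cl4 ::
  "('n::{finite, linorder} \<Rightarrow> complex ^ 's ^ 's::finite) \<Rightarrow> ('n \<Rightarrow> 'n \<Rightarrow> 'n \<Rightarrow> 'n \<Rightarrow> real) \<Rightarrow>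
     complex ^ 's ^ 's" where
  "cl4 \<gamma> c =
     (\<Sum>(i, j, k, l) | i < j \<and> j < k \<and> k < l. c i j k l *\<^sub>R (\<gamma> i ** \<gamma> j ** \<gamma> k ** \<gamma> l))"


subsection \<open>Riemannian spin manifolds and spinor fields\<close>

text \<open>The spin structure is given by its transition data: an open cover \<open>U\<^sub>a\<close>, smooth orthonormal
  frames \<open>e\<^sup>a\<close> on \<open>U\<^sub>a\<close>, and a cocycle \<open>h\<^bsub>ab\<^esub> : U\<^sub>a \<inter> U\<^sub>b \<rightarrow> Spin(n)\<close> which is a lift of the cocycle of
  the frames along \<open>Spin(n) \<rightarrow> SO(n)\<close>. In particular all the frames are consistently oriented.\<close>

record ('m, 'n, 's, 'i) spin_mfd =
  charts :: "('m set \<times> ('m \<Rightarrow> real ^ 'n::finite)) set"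
  met :: "'m \<Rightarrow> (('m \<Rightarrow> real) \<Rightarrow> real) \<Rightarrow> (('m \<Rightarrow> real) \<Rightarrow> real) \<Rightarrow> real"
  gam :: "'n \<Rightarrow> complex ^ 's ^ 's::finite"
  cover :: "'i \<Rightarrow> 'm set"
  frame :: "'i \<Rightarrow> 'n \<Rightarrow> 'm \<Rightarrow> ('m \<Rightarrow> real) \<Rightarrow> real"
  lift :: "'i \<Rightarrow> 'i \<Rightarrow> 'm \<Rightarrow> complex ^ 's ^ 's"

definition orthonormal_frame ::
  "('m::topological_space, 'n::finite) atlas \<Rightarrow> 'm bilin \<Rightarrow> 'm set \<Rightarrow> ('n \<Rightarrow> 'm vfield) \<Rightarrow> bool" where
  "orthonormal_frame A g U e \<longleftrightarrow>
     (\<forall>i. vector_field_on A U (e i)) \<and>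
     (\<forall>p\<in>U. \<forall>i j. g p (e i p) (e j p) = (if i = j then 1 else 0)) \<and>
     (\<forall>p\<in>U. \<forall>v\<in>tangent_space A p. \<exists>c. v = (\<lambda>f. \<Sum>i\<in>UNIV. c i * e i p f))"

text \<open>The last condition says \<open>h\<^bsub>ab\<^esub> \<gamma>\<^sub>i h\<^bsub>ab\<^esub>\<^sup>-\<^sup>1 = \<Sum>\<^sub>j g(e\<^sup>b\<^sub>i, e\<^sup>a\<^sub>j) \<gamma>\<^sub>j\<close>, that is, \<open>h\<^bsub>ab\<^esub>\<close> covers the
  rotation taking \<open>e\<^sup>a\<close> to \<open>e\<^sup>b\<close>.\<close>

definition spin_structure ::
  "('m::topological_space, 'n::finite, 's::finite, 'i) spin_mfd \<Rightarrow> bool" where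
  "spin_structure M \<longleftrightarrow>
     clifford_matrices (gam M) \<and>
     (\<Union>a. cover M a) = UNIV \<and>
     (\<forall>a. open (cover M a) \<and> orthonormal_frame (charts M) (met M) (cover M a) (frame M a)) \<and>
     (\<forall>a b. \<forall>p\<in>cover M a \<inter> cover M b.
        lift M a b p \<in> spin_group (gam M) \<and>
        (\<forall>s t. smooth_at (charts M) p (\<lambda>x. Re (lift M a b x $ s $ t)) \<and>
               smooth_at (charts M) p (\<lambda>x. Im (lift M a b x $ s $ t)))) \<and>
     (\<forall>a b c. \<forall>p\<in>cover M a \<inter> cover M b \<inter> cover M c.
        lift M a b p ** lift M b c p = lift M a c p) \<and>
     (\<forall>a b. \<forall>p\<in>cover M a \<inter> cover M b. \<forall>i.
        lift M a b p ** gam M i =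
          (\<Sum>j\<in>UNIV. met M p (frame M b i p) (frame M a j p) *\<^sub>R gam M j) ** lift M a b p)"

definition riemannian_spin_manifold ::
  "('m::topological_space, 'n::finite, 's::finite, 'i) spin_mfd \<Rightarrow> bool" where
  "riemannian_spin_manifold M \<longleftrightarrow>
     smooth_atlas (charts M) \<and> riemannian_metric (charts M) (met M) \<and> spin_structure M"

text \<open>A spinor field is a section of the bundle associated to the spin structure, given by its
  components \<open>\<psi>\<^sub>a\<close> with respect to the local trivialisations.\<close>

type_synonym ('m, 's, 'i) spinor = "'i \<Rightarrow> 'm \<Rightarrow> complex ^ 's"

definition spinor_field ::
  "('m::topological_space, 'n::finite, 's::finite, 'i) spin_mfd \<Rightarrow> ('m, 's, 'i) spinor \<Rightarrow> bool" where
  "spinor_field M \<psi> \<longleftrightarrow>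
     (\<forall>a. \<forall>p\<in>cover M a. \<forall>s. smooth_at (charts M) p (\<lambda>x. Re (\<psi> a x $ s)) \<and>
                            smooth_at (charts M) p (\<lambda>x. Im (\<psi> a x $ s))) \<and>
     (\<forall>a b. \<forall>p\<in>cover M a \<inter> cover M b. \<psi> a p = lift M a b p *v \<psi> b p)"


subsection \<open>Operators on spinor fields\<close>

text \<open>Derivative of a vector-valued function along a tangent vector.\<close>

definition vec_deriv :: "'m tvec \<Rightarrow> ('m \<Rightarrow> complex ^ 's::finite) \<Rightarrow> complex ^ 's" where
  "vec_deriv v \<psi> = (\<chi> s. Complex (v (\<lambda>x. Re (\<psi> x $ s))) (v (\<lambda>x. Im (\<psi> x $ s))))"

text \<open>The lift of the Levi-Civita connection,
  \<open>\<nabla>\<^sup>g\<^sub>X \<psi> = X(\<psi>) + \<onehalf> \<Sum>\<^bsub>j<k\<^esub> g(\<nabla>\<^sup>g\<^sub>X e\<^sub>j, e\<^sub>k) \<gamma>\<^sub>j \<gamma>\<^sub>k \<psi>\<close>.\<close>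

definition spin_connection ::
  "('m, 'n::{finite, linorder}, 's::finite, 'i) spin_mfd \<Rightarrow> 'm connection \<Rightarrow> 'm vfield \<Rightarrow>
     ('m, 's, 'i) spinor \<Rightarrow> ('m, 's, 'i) spinor" where
  "spin_connection M LC X \<psi> a p =
     vec_deriv (X p) (\<psi> a)
     + (1 / 2) *\<^sub>R (cl2 (gam M) (\<lambda>j k. met M p (LC X (frame M a j) p) (frame M a k p)) *v \<psi> a p)"

definition dirac ::
  "('m, 'n::{finite, linorder}, 's::finite, 'i) spin_mfd \<Rightarrow> 'm connection \<Rightarrow>
     ('m, 's, 'i) spinor \<Rightarrow> ('m, 's, 'i) spinor" where
  "dirac M LC \<psi> a p = (\<Sum>i\<in>UNIV. gam M i *v spin_connection M LC (frame M a i) \<psi> a p)"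

definition torsion_endo ::
  "('m, 'n::{finite, linorder}, 's::finite, 'i) spin_mfd \<Rightarrow> 'm trilin \<Rightarrow>
     ('m, 's, 'i) spinor \<Rightarrow> ('m, 's, 'i) spinor" where
  "torsion_endo M T \<psi> a p =
     cl3 (gam M) (\<lambda>i j k. T p (frame M a i p) (frame M a j p) (frame M a k p)) *v \<psi> a p"

text \<open>The operator \<open>D\<^bsup>1/3\<^esup>\<close>.\<close>

definition dirac_third ::
  "('m, 'n::{finite, linorder}, 's::finite, 'i) spin_mfd \<Rightarrow> 'm connection \<Rightarrow> 'm trilin \<Rightarrow>
     ('m, 's, 'i) spinor \<Rightarrow> ('m, 's, 'i) spinor" where
  "dirac_third M LC T \<psi> a p = dirac M LC \<psi> a p + (1 / 4) *\<^sub>R torsion_endo M T \<psi> a p"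

definition dirac_third_sq ::
  "('m, 'n::{finite, linorder}, 's::finite, 'i) spin_mfd \<Rightarrow> 'm connection \<Rightarrow> 'm trilin \<Rightarrow>
     ('m, 's, 'i) spinor \<Rightarrow> ('m, 's, 'i) spinor" where
  "dirac_third_sq M LC T \<psi> = dirac_third M LC T (dirac_third M LC T \<psi>)"

text \<open>The remaining ingredients of the Casimir operator are independent of the orthonormal frame;
  they are evaluated in the frame with index \<open>a\<close>.\<close>

definition sigma_form ::
  "('m, 'n::finite, 's::finite, 'i) spin_mfd \<Rightarrow> 'm trilin \<Rightarrow> 'i \<Rightarrow> 'm \<Rightarrow>
     'm tvec \<Rightarrow> 'm tvec \<Rightarrow> 'm tvec \<Rightarrow> 'm tvec \<Rightarrow> real" where
  "sigma_form M T a p x y z w =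
     1 / 2 * (\<Sum>k\<in>UNIV. wedge2 (T p (frame M a k p)) (T p (frame M a k p)) x y z w)"

definition codiff ::
  "('m, 'n::finite, 's::finite, 'i) spin_mfd \<Rightarrow> 'm connection \<Rightarrow> 'm trilin \<Rightarrow> 'i \<Rightarrow>
     'm vfield \<Rightarrow> 'm vfield \<Rightarrow> 'm \<Rightarrow> real" where
  "codiff M LC T a X Y p =
     - (\<Sum>k\<in>UNIV. cov_deriv LC T (frame M a k) (frame M a k) X Y p)"

definition form_norm_sq ::
  "('m, 'n::{finite, linorder}, 's::finite, 'i) spin_mfd \<Rightarrow> 'm trilin \<Rightarrow> 'i \<Rightarrow> 'm \<Rightarrow> real" where
  "form_norm_sq M T a p =
     (\<Sum>(i, j, k) | i < j \<and> j < k. (T p (frame M a i p) (frame M a j p) (frame M a k p))\<^sup>2)"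

definition scal ::
  "('m::topological_space, 'n::finite, 's::finite, 'i) spin_mfd \<Rightarrow> 'm connection \<Rightarrow>
     'i \<Rightarrow> 'm \<Rightarrow> real" where
  "scal M LC a p =
     (\<Sum>i\<in>UNIV. \<Sum>j\<in>UNIV.
        met M p (curvature (charts M) LC (frame M a i) (frame M a j) (frame M a j) p) (frame M a i p))"

definition casimir ::
  "('m::topological_space, 'n::{finite, linorder}, 's::finite, 'i) spin_mfd \<Rightarrow> 'm connection \<Rightarrow>
     'm trilin \<Rightarrow> ('m, 's, 'i) spinor \<Rightarrow> ('m, 's, 'i) spinor" where
  "casimir M LC T \<psi> a p =
     dirac_third_sq M LC T \<psi> a p
     + (1 / 8) *\<^sub>R (cl4 (gam M) (\<lambda>i j k l.
          ext_deriv (charts M) T (frame M a i) (frame M a j) (frame M a k) (frame M a l) p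
          - 2 * sigma_form M T a p (frame M a i p) (frame M a j p) (frame M a k p) (frame M a l p))
        *v \<psi> a p)
     + (1 / 4) *\<^sub>R (cl2 (gam M) (\<lambda>i j. codiff M LC T a (frame M a i) (frame M a j) p) *v \<psi> a p)
     - (1 / 8 * scal M LC a p) *\<^sub>R \<psi> a p
     - (1 / 16 * form_norm_sq M T a p) *\<^sub>R \<psi> a p"

text \<open>The components of a spinor field outside of \<open>cover M a\<close> are irrelevant.\<close>

definition commute_on_spinors ::
  "('m::topological_space, 'n::finite, 's::finite, 'i) spin_mfd \<Rightarrow>
     (('m, 's, 'i) spinor \<Rightarrow> ('m, 's, 'i) spinor) \<Rightarrow>
     (('m, 's, 'i) spinor \<Rightarrow> ('m, 's, 'i) spinor) \<Rightarrow> bool" where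
  "commute_on_spinors M P Q \<longleftrightarrow>
     (\<forall>\<psi>. spinor_field M \<psi> \<longrightarrow> (\<forall>a. \<forall>p\<in>cover M a. P (Q \<psi>) a p = Q (P \<psi>) a p))"

end

theory Submission
  imports Defs
begin

text \<open>
  All operators are differential operators, so their values at a point can be computed in one local
  orthonormal frame \<open>e\<^sub>i\<close>. Write \<open>\<nabla>\<close> for the torsion connection, on vectors and on spinors, and \<open>D\<close>
  for its Dirac operator \<open>\<Sum>\<^sub>i e\<^sub>i \<cdot> \<nabla>\<^sub>i\<close>. As \<open>\<Sum>\<^sub>i e\<^sub>i \<cdot> (e\<^sub>i \<rfloor> T) = 3 T\<close> (\<open>act3_contraction\<close>), the operator
  \<open>D\<^bsup>1/3\<^esup>\<close> is \<open>D - \<onehalf> T\<close>.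

  Since \<open>T\<close> is parallel, \<open>\<nabla>\<^sub>i\<close> commutes with Clifford multiplication by \<open>T\<close> (\<open>nab_tor\<close>). Hence
  \<open>D T + T D = \<Sum>\<^sub>i (e\<^sub>i T + T e\<^sub>i) \<cdot> \<nabla>\<^sub>i = - 2 \<Sum>\<^sub>i (e\<^sub>i \<rfloor> T) \<cdot> \<nabla>\<^sub>i\<close>. On the other hand the commutator of
  second covariant derivatives is curvature minus a torsion term, so \<open>D\<^sup>2\<close> is the spinor Laplacian
  plus \<open>\<onehalf> \<Sum>\<^bsub>k,l\<^esub> e\<^sub>k e\<^sub>l R(e\<^sub>k, e\<^sub>l)\<close> minus the first order operator \<open>\<Sum>\<^sub>i (e\<^sub>i \<rfloor> T) \<cdot> \<nabla>\<^sub>i\<close>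
  (\<open>dirac_op_sq\<close>). In \<open>(D - \<onehalf> T)\<^sup>2\<close> the first order terms cancel, and the square of \<open>D\<^bsup>1/3\<^esup>\<close> is the
  Laplacian plus the curvature term plus \<open>\<onequarter> T\<^sup>2\<close> (\<open>dirac_third_op_sq\<close>).

  Each summand commutes with \<open>T\<close>. The Laplacian is built from \<open>\<nabla>\<close>. For the curvature term,
  \<open>R(e\<^sub>k, e\<^sub>l)\<close> acts on spinors as a commutator of covariant derivatives, so it commutes with \<open>T\<close>
  (\<open>curv_tor\<close>). The factor \<open>e\<^sub>k e\<^sub>l\<close> does not, but the components of \<open>R\<close> satisfy
  \<open>R\<^bsub>klij\<^esub> = R\<^bsub>ijkl\<^esub>\<close> (\<open>pair_symmetry\<close>), which allows the two factors to exchange roles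
  (\<open>curv_endo_tor\<close>). The pair symmetry holds because \<open>\<nabla>T = 0\<close> turns the first Bianchi identity into
  the statement that the cyclic sum of \<open>R\<close> is a \<open>4\<close>-form quadratic in \<open>T\<close> (\<open>bianchi\<close>), and a
  \<open>4\<close>-form contributes nothing to the usual derivation of the symmetry.

  Finally \<open>\<nabla>T = 0\<close> implies \<open>dT = 2 \<sigma>\<^sub>T\<close> and \<open>\<delta>T = 0\<close> (\<open>ext_deriv_eq_sigma\<close>, \<open>codifferential_zero\<close>), so
  the Casimir operator differs from \<open>(D\<^bsup>1/3\<^esup>)\<^sup>2\<close> by multiplication with a function.

  The calculus is developed for an abstract family of derivations with a Clifford action on a
  Euclidean space, which keeps the manifold out of the computation; a local orthonormal frame is then
  shown to be an instance.
\<close>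

section \<open>Clifford multiplication by forms\<close>

text \<open>The generators act as linear maps on a real vector space rather than as elements of an
  algebra. Products are then compositions, and real coefficients are the only scalars that occur.\<close>

locale clifford_action =
  fixes G :: "'n::finite \<Rightarrow> 'v::real_vector \<Rightarrow> 'v"
  assumes linear_G: "linear (G i)"
    and clifford: "G i (G j x) + G j (G i x) = (if i = j then - 2 else 0) *\<^sub>R x"
begin

text \<open>For skew coefficients this is Clifford multiplication by the form
  \<open>\<Sum>\<^bsub>i<j\<^esub> c\<^bsub>ij\<^esub> e\<^sub>i \<and> e\<^sub>j\<close>, and similarly for \<open>act3\<close> below. Sums over all index tuples, with a
  factor for the repetitions, are easier to reindex than sums over increasing tuples.\<close>

definition act2 :: "('n \<Rightarrow> 'n \<Rightarrow> real) \<Rightarrow> 'v \<Rightarrow> 'v" where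
  "act2 c x = (1 / 2) *\<^sub>R (\<Sum>i\<in>UNIV. \<Sum>j\<in>UNIV. c i j *\<^sub>R G i (G j x))"

definition act3 :: "('n \<Rightarrow> 'n \<Rightarrow> 'n \<Rightarrow> real) \<Rightarrow> 'v \<Rightarrow> 'v" where
  "act3 t x = (1 / 6) *\<^sub>R (\<Sum>i\<in>UNIV. \<Sum>j\<in>UNIV. \<Sum>k\<in>UNIV. t i j k *\<^sub>R G i (G j (G k x)))"

lemmas G_linear_simps =
  linear_add[OF linear_G] linear_diff[OF linear_G] linear_scale[OF linear_G]
  linear_sum[OF linear_G] linear_neg[OF linear_G] linear_0[OF linear_G]

lemma linear_act2: "linear (act2 c)"
  by (rule linearI)
    (simp_all add: act2_def G_linear_simps scaleR_add_right sum.distrib scaleR_right.sum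
      scaleR_left_commute mult.commute)

lemma linear_act3: "linear (act3 t)"
  by (rule linearI)
    (simp_all add: act3_def G_linear_simps scaleR_add_right sum.distrib scaleR_right.sum
      scaleR_left_commute mult.commute)

lemma act2_add: "act2 (\<lambda>i j. b i j + c i j) x = act2 b x + act2 c x"
  by (simp add: act2_def scaleR_left_distrib scaleR_add_right sum.distrib)

lemma act2_diff: "act2 (\<lambda>i j. b i j - c i j) x = act2 b x - act2 c x"
  by (simp add: act2_def scaleR_left_diff_distrib scaleR_diff_right sum_subtractf)

lemma act2_scale: "act2 (\<lambda>i j. r * c i j) x = r *\<^sub>R act2 c x"
  by (simp add: act2_def scaleR_right.sum mult.commute mult.left_commute)

lemma act2_sum: "act2 (\<lambda>i j. \<Sum>m\<in>M. c m i j) x = (\<Sum>m\<in>M. act2 (c m) x)"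
  by (induction M rule: infinite_finite_induct) (simp_all add: act2_add, simp_all add: act2_def)

lemma pair_commute:
  "G a (G b (G k x)) =
     G k (G a (G b x)) + (if a = k then 2 else 0) *\<^sub>R G b x - (if b = k then 2 else 0) *\<^sub>R G a x"
proof -
  have "G a (G b (G k x)) = G a ((if b = k then - 2 else 0) *\<^sub>R x - G k (G b x))"
    by (subst clifford[of b k x, symmetric]) simp
  moreover have "G a (G k (G b x)) = (if a = k then - 2 else 0) *\<^sub>R G b x - G k (G a (G b x))"
    by (subst clifford[of a k "G b x", symmetric]) simp
  ultimately show ?thesis
    by (simp add: G_linear_simps)
qed

text \<open>Half of \<open>act2 c\<close> is the spin representation of the skew matrix \<open>c\<close>: its commutator with
  Clifford multiplication by a vector is the rotation generated by \<open>c\<close>.\<close>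

lemma act2_G:
  assumes skew: "\<And>i j. c j i = - c i j"
  shows "act2 c (G k x) = G k (act2 c x) + 2 *\<^sub>R (\<Sum>m\<in>UNIV. c k m *\<^sub>R G m x)"
proof -
  have "(\<Sum>i\<in>UNIV. \<Sum>j\<in>UNIV. c i j *\<^sub>R G i (G j (G k x))) =
      (\<Sum>i\<in>UNIV. \<Sum>j\<in>UNIV. c i j *\<^sub>R G k (G i (G j x)))
      + (\<Sum>i\<in>UNIV. \<Sum>j\<in>UNIV. if i = k then (2 * c i j) *\<^sub>R G j x else 0)
      - (\<Sum>i\<in>UNIV. \<Sum>j\<in>UNIV. if j = k then (2 * c i j) *\<^sub>R G i x else 0)"
    unfolding sum.distrib[symmetric] sum_subtractf[symmetric]
    by (intro sum.cong refl) (subst pair_commute, simp add: scaleR_add_right scaleR_diff_right mult.commute)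
  also have "(\<Sum>i\<in>UNIV. \<Sum>j\<in>UNIV. if i = k then (2 * c i j) *\<^sub>R G j x else 0) =
      2 *\<^sub>R (\<Sum>m\<in>UNIV. c k m *\<^sub>R G m x)"
    by (subst sum.swap) (simp add: scaleR_right.sum)
  also have "(\<Sum>i\<in>UNIV. \<Sum>j\<in>UNIV. if j = k then (2 * c i j) *\<^sub>R G i x else 0) =
      - 2 *\<^sub>R (\<Sum>m\<in>UNIV. c k m *\<^sub>R G m x)"
    by (simp add: scaleR_right.sum skew[of k] sum_negf)
  finally have "(\<Sum>i\<in>UNIV. \<Sum>j\<in>UNIV. c i j *\<^sub>R G i (G j (G k x))) =
      G k (\<Sum>i\<in>UNIV. \<Sum>j\<in>UNIV. c i j *\<^sub>R (G i (G j x)))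
       + 4 *\<^sub>R (\<Sum>m\<in>UNIV. c k m *\<^sub>R G m x)"
    by (simp add: G_linear_simps) (simp flip: scaleR_add_left)
  then show ?thesis
    by (simp add: act2_def G_linear_simps scaleR_add_right)
qed

text \<open>The spin representation is a homomorphism of Lie algebras. This follows by applying \<open>act2_G\<close> to
  each of the two vectors in \<open>act2 b\<close>.\<close>

lemma act2_act2:
  assumes skew: "\<And>i j. c j i = - c i j"
  shows "act2 c (act2 b x) =
    act2 b (act2 c x) + 2 *\<^sub>R act2 (\<lambda>i j. \<Sum>m\<in>UNIV. c m i * b m j + c m j * b i m) x"
proof -
  interpret L: linear "act2 c" by (rule linear_act2)
  have step: "act2 c (G i (G j x)) = G i (G j (act2 c x))
      + 2 *\<^sub>R (\<Sum>m\<in>UNIV. c i m *\<^sub>R G m (G j x)) + 2 *\<^sub>R (\<Sum>m\<in>UNIV. c j m *\<^sub>R G i (G m x))" for i j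
    by (simp add: act2_G[OF skew] G_linear_simps)
  have s1: "(\<Sum>i\<in>UNIV. \<Sum>j\<in>UNIV. \<Sum>m\<in>UNIV. (b i j * c i m) *\<^sub>R G m (G j x)) =
      (\<Sum>i\<in>UNIV. \<Sum>j\<in>UNIV. \<Sum>m\<in>UNIV. (c m i * b m j) *\<^sub>R G i (G j x))" (is "?l = ?r")
  proof -
    have "?l = (\<Sum>(i,j,m)\<in>UNIV. (b i j * c i m) *\<^sub>R G m (G j x))"
      by (simp add: sum.cartesian_product)
    also have "\<dots> = (\<Sum>(i,j,m)\<in>UNIV. (c m i * b m j) *\<^sub>R G i (G j x))"
      by (rule sum.reindex_bij_witness[where i="\<lambda>(i,j,m). (m,j,i)" and j="\<lambda>(i,j,m). (m,j,i)"])
        (auto simp: mult.commute)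
    finally show ?thesis by (simp add: sum.cartesian_product)
  qed
  have s2: "(\<Sum>i\<in>UNIV. \<Sum>j\<in>UNIV. \<Sum>m\<in>UNIV. (b i j * c j m) *\<^sub>R G i (G m x)) =
      (\<Sum>i\<in>UNIV. \<Sum>j\<in>UNIV. \<Sum>m\<in>UNIV. (c m j * b i m) *\<^sub>R G i (G j x))"
    apply (rule sum.cong[OF refl])
    apply (subst sum.swap)
    by (simp add: mult.commute)
  have "act2 c (act2 b x) = (1 / 2) *\<^sub>R (\<Sum>i\<in>UNIV. \<Sum>j\<in>UNIV. b i j *\<^sub>R act2 c (G i (G j x)))"
    by (simp add: act2_def[of b] L.scale L.sum)
  also have "\<dots> = act2 b (act2 c x)
     + ((\<Sum>i\<in>UNIV. \<Sum>j\<in>UNIV. \<Sum>m\<in>UNIV. (b i j * c i m) *\<^sub>R G m (G j x))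
     + (\<Sum>i\<in>UNIV. \<Sum>j\<in>UNIV. \<Sum>m\<in>UNIV. (b i j * c j m) *\<^sub>R G i (G m x)))"
    by (simp add: step act2_def[of b] scaleR_add_right scaleR_right.sum sum.distrib)
  also have "\<dots> = act2 b (act2 c x) + 2 *\<^sub>R act2 (\<lambda>i j. \<Sum>m\<in>UNIV. c m i * b m j + c m j * b i m) x"
    unfolding s1 s2
    by (simp add: act2_def scaleR_left.sum scaleR_add_left sum.distrib)
  finally show ?thesis .
qed

text \<open>The commutator with a \<open>3\<close>-form is the derivation action on its three slots, again by
  \<open>act2_G\<close>.\<close>

lemma act2_act3:
  assumes skew: "\<And>i j. c j i = - c i j"
  shows "act2 c (act3 t x) = act3 t (act2 c x) - 2 *\<^sub>R
    act3 (\<lambda>i j k. \<Sum>m\<in>UNIV. c i m * t m j k + c j m * t i m k + c k m * t i j m) x"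
proof -
  interpret L: linear "act2 c" by (rule linear_act2)
  have step: "act2 c (G i (G j (G k x))) = G i (G j (G k (act2 c x)))
      - 2 *\<^sub>R ((\<Sum>m\<in>UNIV. c m i *\<^sub>R G m (G j (G k x))) + (\<Sum>m\<in>UNIV. c m j *\<^sub>R G i (G m (G k x)))
      + (\<Sum>m\<in>UNIV. c m k *\<^sub>R G i (G j (G m x))))" for i j k
    by (simp add: act2_G[OF skew] G_linear_simps skew[of i] skew[of j] skew[of k] sum_negf scaleR_add_right)
  have s1: "(\<Sum>i\<in>UNIV. \<Sum>j\<in>UNIV. \<Sum>k\<in>UNIV. \<Sum>m\<in>UNIV. (t i j k * c m i) *\<^sub>R G m (G j (G k x))) =
      (\<Sum>i\<in>UNIV. \<Sum>j\<in>UNIV. \<Sum>k\<in>UNIV. \<Sum>m\<in>UNIV. (c i m * t m j k) *\<^sub>R G i (G j (G k x)))" (is "?l = ?r")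
  proof -
    have "?l = (\<Sum>(i,j,k,m)\<in>UNIV. (t i j k * c m i) *\<^sub>R G m (G j (G k x)))"
      by (simp add: sum.cartesian_product)
    also have "\<dots> = (\<Sum>(i,j,k,m)\<in>UNIV. (c i m * t m j k) *\<^sub>R G i (G j (G k x)))"
      by (rule sum.reindex_bij_witness[where i="\<lambda>(i,j,k,m). (m,j,k,i)" and j="\<lambda>(i,j,k,m). (m,j,k,i)"])
        (auto simp: mult.commute)
    finally show ?thesis by (simp add: sum.cartesian_product)
  qed
  have s2: "(\<Sum>i\<in>UNIV. \<Sum>j\<in>UNIV. \<Sum>k\<in>UNIV. \<Sum>m\<in>UNIV. (t i j k * c m j) *\<^sub>R G i (G m (G k x))) =
      (\<Sum>i\<in>UNIV. \<Sum>j\<in>UNIV. \<Sum>k\<in>UNIV. \<Sum>m\<in>UNIV. (c j m * t i m k) *\<^sub>R G i (G j (G k x)))" (is "?l = ?r")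
  proof -
    have "?l = (\<Sum>(i,j,k,m)\<in>UNIV. (t i j k * c m j) *\<^sub>R G i (G m (G k x)))"
      by (simp add: sum.cartesian_product)
    also have "\<dots> = (\<Sum>(i,j,k,m)\<in>UNIV. (c j m * t i m k) *\<^sub>R G i (G j (G k x)))"
      by (rule sum.reindex_bij_witness[where i="\<lambda>(i,j,k,m). (i,m,k,j)" and j="\<lambda>(i,j,k,m). (i,m,k,j)"])
        (auto simp: mult.commute)
    finally show ?thesis by (simp add: sum.cartesian_product)
  qed
  have s3: "(\<Sum>i\<in>UNIV. \<Sum>j\<in>UNIV. \<Sum>k\<in>UNIV. \<Sum>m\<in>UNIV. (t i j k * c m k) *\<^sub>R G i (G j (G m x))) =
      (\<Sum>i\<in>UNIV. \<Sum>j\<in>UNIV. \<Sum>k\<in>UNIV. \<Sum>m\<in>UNIV. (c k m * t i j m) *\<^sub>R G i (G j (G k x)))" (is "?l = ?r")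
  proof -
    have "?l = (\<Sum>(i,j,k,m)\<in>UNIV. (t i j k * c m k) *\<^sub>R G i (G j (G m x)))"
      by (simp add: sum.cartesian_product)
    also have "\<dots> = (\<Sum>(i,j,k,m)\<in>UNIV. (c k m * t i j m) *\<^sub>R G i (G j (G k x)))"
      by (rule sum.reindex_bij_witness[where i="\<lambda>(i,j,k,m). (i,j,m,k)" and j="\<lambda>(i,j,k,m). (i,j,m,k)"])
        (auto simp: mult.commute)
    finally show ?thesis by (simp add: sum.cartesian_product)
  qed
  have "act2 c (act3 t x) =
      (1 / 6) *\<^sub>R (\<Sum>i\<in>UNIV. \<Sum>j\<in>UNIV. \<Sum>k\<in>UNIV. t i j k *\<^sub>R act2 c (G i (G j (G k x))))"
    by (simp add: act3_def[of t] L.scale L.sum)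
  also have "\<dots> = act3 t (act2 c x) - (1 / 3) *\<^sub>R
     ((\<Sum>i\<in>UNIV. \<Sum>j\<in>UNIV. \<Sum>k\<in>UNIV. \<Sum>m\<in>UNIV. (t i j k * c m i) *\<^sub>R G m (G j (G k x)))
     + (\<Sum>i\<in>UNIV. \<Sum>j\<in>UNIV. \<Sum>k\<in>UNIV. \<Sum>m\<in>UNIV. (t i j k * c m j) *\<^sub>R G i (G m (G k x)))
     + (\<Sum>i\<in>UNIV. \<Sum>j\<in>UNIV. \<Sum>k\<in>UNIV. \<Sum>m\<in>UNIV. (t i j k * c m k) *\<^sub>R G i (G j (G m x))))"
    by (simp add: step act3_def[of t] scaleR_add_right scaleR_diff_right scaleR_right.sum sum.distrib
        sum_subtractf mult.commute mult.left_commute)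
  also have "\<dots> = act3 t (act2 c x) - 2 *\<^sub>R
      act3 (\<lambda>i j k. \<Sum>m\<in>UNIV. c i m * t m j k + c j m * t i m k + c k m * t i j m) x"
    unfolding s1 s2 s3
    by (simp add: act3_def scaleR_add_right scaleR_left.sum scaleR_add_left sum.distrib)
  finally show ?thesis .
qed

text \<open>Moving \<open>e\<^sub>l\<close> through three generators costs a sign and one contraction for each of them; by
  alternation the three contractions agree. The wedge parts of the two products cancel.\<close>

lemma act3_anticommutator:
  assumes alt: "\<And>i j k. t j i k = - t i j k" "\<And>i j k. t i k j = - t i j k"
  shows "G l (act3 t x) + act3 t (G l x) = - 2 *\<^sub>R act2 (t l) x"
proof -
  have step: "G i (G j (G k (G l x))) = - G l (G i (G j (G k x)))
      - ((if k = l then 2 *\<^sub>R G i (G j x) else 0) - (if j = l then 2 *\<^sub>R G i (G k x) else 0)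
         + (if i = l then 2 *\<^sub>R G j (G k x) else 0))" for i j k
  proof -
    have "G i (G l y) = (if i = l then - 2 else 0) *\<^sub>R y - G l (G i y)" for i y
      by (subst clifford[of i l, symmetric]) simp
    note h = this[of k x] this[of j "G k x"] this[of i "G j (G k x)"]
    show ?thesis
      by (simp only: h G_linear_simps) auto
  qed
  have cyc: "t i j l = t l i j" "t i l j = - t l i j" for i j
    using alt(1)[of i l j] alt(2)[of i j l] by simp_all
  have "act3 t (G l x) = - G l (act3 t x) - (1 / 6) *\<^sub>R
      ((\<Sum>i\<in>UNIV. \<Sum>j\<in>UNIV. \<Sum>k\<in>UNIV. if k = l then (2 * t i j k) *\<^sub>R G i (G j x) else 0)
      - (\<Sum>i\<in>UNIV. \<Sum>k\<in>UNIV. \<Sum>j\<in>UNIV. if j = l then (2 * t i j k) *\<^sub>R G i (G k x) else 0)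
      + (\<Sum>j\<in>UNIV. \<Sum>k\<in>UNIV. \<Sum>i\<in>UNIV. if i = l then (2 * t i j k) *\<^sub>R G j (G k x) else 0))"
  proof -
    have "(\<Sum>i\<in>UNIV. \<Sum>k\<in>UNIV. \<Sum>j\<in>UNIV. if j = l then (2 * t i j k) *\<^sub>R G i (G k x) else 0)
       = (\<Sum>i\<in>UNIV. \<Sum>j\<in>UNIV. \<Sum>k\<in>UNIV. if j = l then (2 * t i j k) *\<^sub>R G i (G k x) else 0)"
      by (intro sum.cong refl sum.swap)
    moreover have "(\<Sum>j\<in>UNIV. \<Sum>k\<in>UNIV. \<Sum>i\<in>UNIV. if i = l then (2 * t i j k) *\<^sub>R G j (G k x) else 0)
       = (\<Sum>i\<in>UNIV. \<Sum>j\<in>UNIV. \<Sum>k\<in>UNIV. if i = l then (2 * t i j k) *\<^sub>R G j (G k x) else 0)"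
      by (subst (2) sum.swap, subst sum.swap) (rule refl)
    ultimately show ?thesis
      unfolding act3_def
      apply (simp only: G_linear_simps scaleR_minus_right[symmetric] scaleR_diff_right[symmetric]
          sum.distrib[symmetric] sum_subtractf[symmetric] sum_negf[symmetric])
      apply (intro arg_cong[where f="\<lambda>x. (1/6) *\<^sub>R x"] sum.cong refl)
      apply (subst step)
      by (simp add: scaleR_add_right scaleR_diff_right mult.commute)
  qed
  also have "(\<Sum>i\<in>UNIV. \<Sum>j\<in>UNIV. \<Sum>k\<in>UNIV. if k = l then (2 * t i j k) *\<^sub>R G i (G j x) else 0) =
      4 *\<^sub>R act2 (t l) x"
    by (simp add: act2_def cyc scaleR_right.sum)
  also have "(\<Sum>i\<in>UNIV. \<Sum>k\<in>UNIV. \<Sum>j\<in>UNIV. if j = l then (2 * t i j k) *\<^sub>R G i (G k x) else 0) =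
      - 4 *\<^sub>R act2 (t l) x"
    by (simp add: act2_def cyc scaleR_right.sum sum_negf)
  also have "(\<Sum>j\<in>UNIV. \<Sum>k\<in>UNIV. \<Sum>i\<in>UNIV. if i = l then (2 * t i j k) *\<^sub>R G j (G k x) else 0) =
      4 *\<^sub>R act2 (t l) x"
    by (simp add: act2_def scaleR_right.sum)
  finally show ?thesis
    by (simp flip: scaleR_add_left)
qed

lemma act3_contraction: "(\<Sum>l\<in>UNIV. G l (act2 (t l) x)) = 3 *\<^sub>R act3 t x"
  by (simp add: act2_def act3_def G_linear_simps scaleR_right.sum)

end

lemma scaleR_matrix_vector: "(r *\<^sub>R B) *v x = r *\<^sub>R (B *v x)"
  for B :: "complex ^ 's ^ 's::finite"
  by (simp add: vec_eq_iff matrix_vector_mult_def scaleR_right.sum)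

lemma sum_matrix_vector: "(\<Sum>i\<in>I. B i) *v x = (\<Sum>i\<in>I. B i *v x)"
  for B :: "'i \<Rightarrow> complex ^ 's ^ 's::finite"
  by (induction I rule: infinite_finite_induct) (simp_all add: matrix_vector_mult_add_rdistrib)

lemma linear_matrix_vector: "linear (\<lambda>x. B *v x)"
  for B :: "complex ^ 's ^ 's::finite"
  by (rule linearI) (simp_all add: vec_eq_iff matrix_vector_mult_def algebra_simps sum.distrib scaleR_right.sum)

lemma clifford_matrices_action:
  assumes "clifford_matrices \<gamma>"
  shows "clifford_action (\<lambda>i x. \<gamma> i *v x)"
proof (rule clifford_action.intro)
  fix i j x
  show "linear (\<lambda>x. \<gamma> i *v x)"
    by (rule linear_matrix_vector)
  have "\<gamma> i *v (\<gamma> j *v x) + \<gamma> j *v (\<gamma> i *v x) = mat (if i = j then - 2 else 0) *v x"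
    using assms by (simp add: clifford_matrices_def matrix_vector_mul_assoc flip: matrix_vector_mult_add_rdistrib)
  also have "\<dots> = (if i = j then - 2 else 0) *\<^sub>R x"
    by (simp add: vec_eq_iff matrix_vector_mult_def mat_def if_distrib[of "\<lambda>z. z * _"] scaleR_conv_of_real cong: if_cong)
  finally show "\<gamma> i *v (\<gamma> j *v x) + \<gamma> j *v (\<gamma> i *v x) = (if i = j then - 2 else 0) *\<^sub>R x" .
qed

lemma sum_pairs_symmetric:
  fixes F :: "'n::{finite, linorder} \<Rightarrow> 'n \<Rightarrow> 'v::real_vector"
  assumes "\<And>i j. F j i = F i j" "\<And>i. F i i = 0"
  shows "(\<Sum>i\<in>UNIV. \<Sum>j\<in>UNIV. F i j) = 2 *\<^sub>R (\<Sum>(i, j) | i < j. F i j)"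
proof -
  let ?P = "\<lambda>i j. if i < j then F i j else 0"
  have "F i j = ?P i j + ?P j i" for i j
    using assms by (cases i j rule: linorder_cases) auto
  then have "(\<Sum>i\<in>UNIV. \<Sum>j\<in>UNIV. F i j) = (\<Sum>i\<in>UNIV. \<Sum>j\<in>UNIV. ?P i j) + (\<Sum>i\<in>UNIV. \<Sum>j\<in>UNIV. ?P j i)"
    unfolding sum.distrib[symmetric] by (intro sum.cong refl)
  also have "(\<Sum>i\<in>UNIV. \<Sum>j\<in>UNIV. ?P j i) = (\<Sum>i\<in>UNIV. \<Sum>j\<in>UNIV. ?P i j)"
    by (rule sum.swap)
  also have "(\<Sum>i\<in>UNIV. \<Sum>j\<in>UNIV. ?P i j) = (\<Sum>(i, j)\<in>UNIV. ?P i j)"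
    by (simp add: sum.cartesian_product)
  also have "\<dots> = (\<Sum>(i, j) | i < j. F i j)"
    by (rule sum.mono_neutral_cong_right) (auto split: if_splits)
  finally show ?thesis
    by (simp add: scaleR_2)
qed

text \<open>A triple of distinct indices has exactly one increasing rearrangement, so the sum splits into
  six copies of the sum over increasing triples.\<close>

lemma sum_triples_symmetric:
  fixes F :: "'n::{finite, linorder} \<Rightarrow> 'n \<Rightarrow> 'n \<Rightarrow> 'v::real_vector"
  assumes sym: "\<And>i j k. F j i k = F i j k" "\<And>i j k. F i k j = F i j k"
    and diag: "\<And>i k. F i i k = 0"
  shows "(\<Sum>i\<in>UNIV. \<Sum>j\<in>UNIV. \<Sum>k\<in>UNIV. F i j k) = 6 *\<^sub>R (\<Sum>(i, j, k) | i < j \<and> j < k. F i j k)"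
proof -
  let ?P = "\<lambda>i j k. if i < j \<and> j < k then F i j k else 0"
  let ?s = "\<lambda>f. \<Sum>i\<in>UNIV. \<Sum>j\<in>UNIV. \<Sum>k\<in>UNIV. f i j k :: 'v"
  have perm: "F j i k = F i j k" "F i k j = F i j k" "F k i j = F i j k" "F j k i = F i j k" "F k j i = F i j k" for i j k
    using sym by metis+
  have diag': "F i k i = 0" "F k i i = 0" for i k
    using perm diag by metis+
  have split: "F i j k = ?P i j k + ?P j i k + ?P i k j + ?P k i j + ?P j k i + ?P k j i" for i j k
    using perm[of i j k] diag diag'
    by (cases i j rule: linorder_cases; cases j k rule: linorder_cases; cases i k rule: linorder_cases) auto
  have swap12: "?s (\<lambda>i j k. f j i k) = ?s f" and swap23: "?s (\<lambda>i j k. f i k j) = ?s f" for f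
    by (rule sum.swap, intro sum.cong refl sum.swap)
  have "?s F = ?s ?P + ?s (\<lambda>i j k. ?P j i k) + ?s (\<lambda>i j k. ?P i k j) + ?s (\<lambda>i j k. ?P k i j)
      + ?s (\<lambda>i j k. ?P j k i) + ?s (\<lambda>i j k. ?P k j i)"
    unfolding sum.distrib[symmetric] by (intro sum.cong refl split)
  also have "?s (\<lambda>i j k. ?P j i k) = ?s ?P"
    by (rule swap12)
  also have "?s (\<lambda>i j k. ?P i k j) = ?s ?P"
    by (rule swap23)
  also have "?s (\<lambda>i j k. ?P k i j) = ?s ?P"
    using swap23[of "\<lambda>i j k. ?P j i k"] swap12[of ?P] by (rule trans)
  also have "?s (\<lambda>i j k. ?P j k i) = ?s ?P"
    using swap12[of "\<lambda>i j k. ?P i k j"] swap23[of ?P] by (rule trans)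
  also have "?s (\<lambda>i j k. ?P k j i) = ?s ?P"
    using swap12[of "\<lambda>i j k. ?P k i j"] swap23[of "\<lambda>i j k. ?P j i k"] swap12[of ?P] by (rule trans[OF _ trans])
  also have "?s ?P = (\<Sum>(i, j, k)\<in>UNIV. ?P i j k)"
    by (simp add: sum.cartesian_product)
  also have "\<dots> = (\<Sum>(i, j, k) | i < j \<and> j < k. F i j k)"
    by (rule sum.mono_neutral_cong_right) (auto split: if_splits)
  moreover have "6 *\<^sub>R x = x + x + x + x + x + x" for x :: 'v
  proof -
    have "6 *\<^sub>R x = (1 + 1 + 1 + 1 + 1 + 1) *\<^sub>R x"
      by simp
    then show ?thesis
      by (simp only: scaleR_add_left scaleR_one)
  qed
  ultimately show ?thesis
    by (simp only:)
qed

lemma cl2_act2: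
  fixes \<gamma> :: "'n::{finite, linorder} \<Rightarrow> complex ^ 's ^ 's::finite"
  assumes "clifford_matrices \<gamma>" and skew: "\<And>i j. c j i = - c i j"
  shows "cl2 \<gamma> c *v x = clifford_action.act2 (\<lambda>i x. \<gamma> i *v x) c x"
proof -
  interpret clifford_action "\<lambda>i x. \<gamma> i *v x"
    by (rule clifford_matrices_action[OF assms(1)])
  have diag: "c i i = 0" for i
    using skew[of i i] by simp
  have "c j i *\<^sub>R (\<gamma> j *v (\<gamma> i *v x)) = c i j *\<^sub>R (\<gamma> i *v (\<gamma> j *v x))" for i j
    using clifford[of i j x] skew[of j i] diag by (cases "i = j") (auto simp: eq_neg_iff_add_eq_0[symmetric])
  from sum_pairs_symmetric[of "\<lambda>i j. c i j *\<^sub>R (\<gamma> i *v (\<gamma> j *v x))", OF this]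
  show ?thesis
    by (simp add: act2_def cl2_def sum_matrix_vector scaleR_matrix_vector matrix_vector_mul_assoc matrix_mul_assoc diag split_def)
qed

lemma cl3_act3:
  fixes \<gamma> :: "'n::{finite, linorder} \<Rightarrow> complex ^ 's ^ 's::finite"
  assumes "clifford_matrices \<gamma>"
    and alt: "\<And>i j k. t j i k = - t i j k" "\<And>i j k. t i k j = - t i j k"
  shows "cl3 \<gamma> t *v x = clifford_action.act3 (\<lambda>i x. \<gamma> i *v x) t x"
proof -
  interpret clifford_action "\<lambda>i x. \<gamma> i *v x"
    by (rule clifford_matrices_action[OF assms(1)])
  have diag: "t i i k = 0" "t i k k = 0" for i k
    using alt(1)[of i i k] alt(2)[of i k k] by simp_all
  have anti: "\<gamma> j *v (\<gamma> i *v y) = - (\<gamma> i *v (\<gamma> j *v y))" if "i \<noteq> j" for i j y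
    using clifford[of i j y] that by (simp add: eq_neg_iff_add_eq_0 add.commute)
  have 1: "t j i k *\<^sub>R (\<gamma> j *v (\<gamma> i *v (\<gamma> k *v x))) = t i j k *\<^sub>R (\<gamma> i *v (\<gamma> j *v (\<gamma> k *v x)))" for i j k
    using alt(1)[of i j k] diag anti[of i j] by (cases "i = j") auto
  have 2: "t i k j *\<^sub>R (\<gamma> i *v (\<gamma> k *v (\<gamma> j *v x))) = t i j k *\<^sub>R (\<gamma> i *v (\<gamma> j *v (\<gamma> k *v x)))" for i j k
    using alt(2)[of i j k] diag anti[of j k] by (cases "j = k") (auto simp: G_linear_simps)
  from sum_triples_symmetric[of "\<lambda>i j k. t i j k *\<^sub>R (\<gamma> i *v (\<gamma> j *v (\<gamma> k *v x)))", OF 1 2]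
  show ?thesis
    by (simp add: act3_def cl3_def sum_matrix_vector scaleR_matrix_vector matrix_vector_mul_assoc matrix_mul_assoc diag split_def)
qed

section \<open>Frames of derivations\<close>

text \<open>The model is a family of vector fields on an open set \<open>U\<close>, acting on functions that are smooth
  on \<open>U\<close>. Functions are total, so all laws are required at points of \<open>U\<close> only, and \<open>d_cong\<close>
  expresses that derivatives at such points do not depend on values elsewhere.\<close>

locale derivation_frame =
  fixes U :: "'m set"
    and smooth :: "('m \<Rightarrow> real) \<Rightarrow> bool"
    and d :: "'n::finite \<Rightarrow> ('m \<Rightarrow> real) \<Rightarrow> 'm \<Rightarrow> real"
  assumes smooth_const: "smooth (\<lambda>q. a)"
    and smooth_add: "smooth f \<Longrightarrow> smooth h \<Longrightarrow> smooth (\<lambda>q. f q + h q)"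
    and smooth_mult: "smooth f \<Longrightarrow> smooth h \<Longrightarrow> smooth (\<lambda>q. f q * h q)"
    and smooth_d: "smooth f \<Longrightarrow> smooth (d i f)"
    and d_const: "p \<in> U \<Longrightarrow> d i (\<lambda>q. a) p = 0"
    and d_add: "smooth f \<Longrightarrow> smooth h \<Longrightarrow> p \<in> U \<Longrightarrow> d i (\<lambda>q. f q + h q) p = d i f p + d i h p"
    and d_mult: "smooth f \<Longrightarrow> smooth h \<Longrightarrow> p \<in> U \<Longrightarrow>
      d i (\<lambda>q. f q * h q) p = f p * d i h p + h p * d i f p"
    and d_cong: "smooth f \<Longrightarrow> (\<And>q. q \<in> U \<Longrightarrow> f q = h q) \<Longrightarrow> p \<in> U \<Longrightarrow> d i f p = d i h p"
begin

lemma smooth_cmult: "smooth f \<Longrightarrow> smooth (\<lambda>q. a * f q)"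
  by (rule smooth_mult[OF smooth_const])

lemma smooth_diff: "smooth f \<Longrightarrow> smooth h \<Longrightarrow> smooth (\<lambda>q. f q - h q)"
  using smooth_add[OF _ smooth_cmult[of h "-1"]] by simp

lemma smooth_sum: "(\<And>a. a \<in> A \<Longrightarrow> smooth (f a)) \<Longrightarrow> smooth (\<lambda>q. \<Sum>a\<in>A. f a q)"
  by (induction A rule: infinite_finite_induct) (simp_all add: smooth_const smooth_add)

lemma d_cmult: "smooth f \<Longrightarrow> p \<in> U \<Longrightarrow> d i (\<lambda>q. a * f q) p = a * d i f p"
  by (simp add: d_mult smooth_const d_const)

lemma d_diff: "smooth f \<Longrightarrow> smooth h \<Longrightarrow> p \<in> U \<Longrightarrow> d i (\<lambda>q. f q - h q) p = d i f p - d i h p"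
  using d_add[OF _ smooth_cmult[of h "-1"], of f p i] d_cmult[of h p i "-1"] by simp

lemma d_sum:
  "(\<And>a. a \<in> A \<Longrightarrow> smooth (f a)) \<Longrightarrow> p \<in> U \<Longrightarrow> d i (\<lambda>q. \<Sum>a\<in>A. f a q) p = (\<Sum>a\<in>A. d i (f a) p)"
  by (induction A rule: infinite_finite_induct) (simp_all add: d_const d_add smooth_sum)

text \<open>Smoothness and derivatives of functions with values in a Euclidean space are taken
  coordinatewise; by \<open>vd_linear\<close> this is independent of coordinates, and the product rule for
  scalar coefficients gives all that is needed for Clifford products.\<close>

definition vsmooth :: "('m \<Rightarrow> 'v::euclidean_space) \<Rightarrow> bool" where
  "vsmooth \<psi> \<longleftrightarrow> (\<forall>b\<in>Basis. smooth (\<lambda>q. \<psi> q \<bullet> b))"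

definition vd :: "'n \<Rightarrow> ('m \<Rightarrow> 'v::euclidean_space) \<Rightarrow> 'm \<Rightarrow> 'v" where
  "vd i \<psi> p = (\<Sum>b\<in>Basis. d i (\<lambda>q. \<psi> q \<bullet> b) p *\<^sub>R b)"

lemma vd_inner: "b \<in> Basis \<Longrightarrow> vd i \<psi> p \<bullet> b = d i (\<lambda>q. \<psi> q \<bullet> b) p"
  by (simp add: vd_def inner_sum_left_Basis)

lemma vsmooth_const: "vsmooth (\<lambda>q. x)"
  by (simp add: vsmooth_def smooth_const)

lemma vsmooth_add: "vsmooth \<psi> \<Longrightarrow> vsmooth \<phi> \<Longrightarrow> vsmooth (\<lambda>q. \<psi> q + \<phi> q)"
  by (simp add: vsmooth_def inner_add_left smooth_add)

lemma vsmooth_scaleR: "smooth f \<Longrightarrow> vsmooth \<psi> \<Longrightarrow> vsmooth (\<lambda>q. f q *\<^sub>R \<psi> q)"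
  by (simp add: vsmooth_def smooth_mult)

lemma vsmooth_sum: "(\<And>a. a \<in> A \<Longrightarrow> vsmooth (\<psi> a)) \<Longrightarrow> vsmooth (\<lambda>q. \<Sum>a\<in>A. \<psi> a q)"
  by (simp add: vsmooth_def inner_sum_left smooth_sum)

lemma vsmooth_vd: "vsmooth \<psi> \<Longrightarrow> vsmooth (vd i \<psi>)"
  by (simp add: vsmooth_def vd_inner smooth_d)

lemma linear_inner_expand:
  assumes "linear L"
  shows "L x \<bullet> b = (\<Sum>a\<in>Basis. (L a \<bullet> b) * (x \<bullet> a))"
proof -
  have "L x = (\<Sum>a\<in>Basis. (x \<bullet> a) *\<^sub>R L a)"
    by (subst euclidean_representation[of x, symmetric]) (simp only: linear_sum[OF assms] linear_scale[OF assms])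
  then show ?thesis
    by (simp add: inner_sum_left mult.commute)
qed

lemma vsmooth_linear:
  assumes "linear L" and "vsmooth \<psi>"
  shows "vsmooth (\<lambda>q. L (\<psi> q))"
  unfolding vsmooth_def
  using assms(2)
  by (subst linear_inner_expand[OF assms(1)]) (auto simp: vsmooth_def intro!: smooth_sum smooth_cmult)

lemma vd_add: "vsmooth \<psi> \<Longrightarrow> vsmooth \<phi> \<Longrightarrow> p \<in> U \<Longrightarrow>
    vd i (\<lambda>q. \<psi> q + \<phi> q) p = vd i \<psi> p + vd i \<phi> p"
  by (rule euclidean_eqI) (simp add: vd_inner inner_add_left d_add vsmooth_def)

lemma vd_scaleR: "smooth f \<Longrightarrow> vsmooth \<psi> \<Longrightarrow> p \<in> U \<Longrightarrow>
    vd i (\<lambda>q. f q *\<^sub>R \<psi> q) p = d i f p *\<^sub>R \<psi> p + f p *\<^sub>R vd i \<psi> p"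
  by (rule euclidean_eqI) (simp add: vd_inner inner_add_left d_mult vsmooth_def)

lemma vd_sum: "(\<And>a. a \<in> A \<Longrightarrow> vsmooth (\<psi> a)) \<Longrightarrow> p \<in> U \<Longrightarrow>
    vd i (\<lambda>q. \<Sum>a\<in>A. \<psi> a q) p = (\<Sum>a\<in>A. vd i (\<psi> a) p)"
  by (rule euclidean_eqI) (simp add: vd_inner inner_sum_left d_sum vsmooth_def)

lemma vd_linear:
  assumes L: "linear L" and \<psi>: "vsmooth \<psi>" and p: "p \<in> U"
  shows "vd i (\<lambda>q. L (\<psi> q)) p = L (vd i \<psi> p)"
proof (rule euclidean_eqI)
  fix b :: 'b assume b: "b \<in> Basis"
  have "vd i (\<lambda>q. L (\<psi> q)) p \<bullet> b = d i (\<lambda>q. \<Sum>a\<in>Basis. (L a \<bullet> b) * (\<psi> q \<bullet> a)) p"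
    by (subst linear_inner_expand[OF L, symmetric]) (rule vd_inner[OF b])
  also have "\<dots> = (\<Sum>a\<in>Basis. (L a \<bullet> b) * (vd i \<psi> p \<bullet> a))"
    using \<psi> p by (subst d_sum) (auto simp: vsmooth_def d_cmult vd_inner smooth_cmult)
  finally show "vd i (\<lambda>q. L (\<psi> q)) p \<bullet> b = L (vd i \<psi> p) \<bullet> b"
    by (subst linear_inner_expand[OF L])
qed

lemma vd_cong: "vsmooth \<psi> \<Longrightarrow> (\<And>q. q \<in> U \<Longrightarrow> \<psi> q = \<phi> q) \<Longrightarrow> p \<in> U \<Longrightarrow> vd i \<psi> p = vd i \<phi> p"
  unfolding vsmooth_def vd_def by (intro sum.cong refl arg_cong2[where f=scaleR] d_cong) auto

text \<open>If the brackets of the fields are \<open>[d\<^sub>k, d\<^sub>l] = \<Sum>\<^sub>m c\<^bsub>klm\<^esub> d\<^sub>m\<close>, then the double bracket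
  \<open>[d\<^sub>k, [d\<^sub>l, d\<^sub>i]]\<close> has the coefficients \<open>d\<^sub>k c\<^bsub>lim\<^esub> + \<Sum>\<^sub>n c\<^bsub>lin\<^esub> c\<^bsub>knm\<^esub>\<close>. Its cyclic sum vanishes on every
  function because composition of operators is associative.\<close>

lemma structure_functions_jacobi:
  assumes smooth_c: "\<And>i j m. smooth (c i j m)"
    and comm: "\<And>k l f q. smooth f \<Longrightarrow> q \<in> U \<Longrightarrow>
      d k (d l f) q - d l (d k f) q = (\<Sum>m\<in>UNIV. c k l m q * d m f q)"
    and f: "smooth f" and p: "p \<in> U"
  shows "(\<Sum>m\<in>UNIV. (d k (c l i m) p + d l (c i k m) p + d i (c k l m) p
      + (\<Sum>n\<in>UNIV. c l i n p * c k n m p + c i k n p * c l n m p + c k l n p * c i n m p)) * d m f p) = 0"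
proof -
  have double: "(d k (d l (d i f)) p - d k (d i (d l f)) p) - (d l (d i (d k f)) p - d i (d l (d k f)) p) =
      (\<Sum>m\<in>UNIV. (d k (c l i m) p + (\<Sum>n\<in>UNIV. c l i n p * c k n m p)) * d m f p)" for k l i
  proof -
    have "d k (d l (d i f)) p - d k (d i (d l f)) p = d k (\<lambda>q. d l (d i f) q - d i (d l f) q) p"
      by (simp add: d_diff smooth_d f p)
    also have "\<dots> = d k (\<lambda>q. \<Sum>m\<in>UNIV. c l i m q * d m f q) p"
      by (rule d_cong) (simp_all add: smooth_diff smooth_d f p comm)
    also have "\<dots> = (\<Sum>m\<in>UNIV. c l i m p * d k (d m f) p + d m f p * d k (c l i m) p)"
      by (simp add: d_sum smooth_mult smooth_c smooth_d f p d_mult)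
    finally have "(d k (d l (d i f)) p - d k (d i (d l f)) p) - (d l (d i (d k f)) p - d i (d l (d k f)) p) =
        (\<Sum>m\<in>UNIV. d k (c l i m) p * d m f p) + (\<Sum>n\<in>UNIV. c l i n p * (d k (d n f) p - d n (d k f) p))"
      by (simp add: comm[OF smooth_d[OF f] p, of l i] sum.distrib sum_subtractf right_diff_distrib mult.commute)
    also have "(\<Sum>n\<in>UNIV. c l i n p * (d k (d n f) p - d n (d k f) p)) =
        (\<Sum>n\<in>UNIV. \<Sum>m\<in>UNIV. c l i n p * c k n m p * d m f p)"
      by (simp add: comm[OF f p] sum_distrib_left mult.assoc)
    also have "\<dots> = (\<Sum>m\<in>UNIV. \<Sum>n\<in>UNIV. c l i n p * c k n m p * d m f p)"
      by (rule sum.swap)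
    finally show ?thesis
      by (simp add: sum.distrib sum_distrib_right distrib_right)
  qed
  show ?thesis
    using double[of k l i] double[of l i k] double[of i k l]
    by (simp add: sum.distrib distrib_right)
qed

end

section \<open>Spinor calculus of a connection with parallel skew torsion\<close>

text \<open>Here \<open>\<omega>\<^bsub>lij\<^esub> = g(\<nabla>\<^bsub>e\<^sub>l\<^esub> e\<^sub>i, e\<^sub>j)\<close> are the connection coefficients in the orthonormal frame, \<open>t\<close> the
  components of the torsion form and \<open>c\<close> the structure functions of the frame. The assumption
  \<open>torsion\<close> is \<open>\<nabla>\<^sub>X Y - \<nabla>\<^sub>Y X - [X, Y] = T(X, Y)\<close>, and \<open>t_parallel\<close> is \<open>\<nabla>T = 0\<close>.\<close>

locale spin_calculus =
  derivation_frame U smooth d + clifford_action G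
  for U :: "'m set" and smooth :: "('m \<Rightarrow> real) \<Rightarrow> bool"
    and d :: "'n::finite \<Rightarrow> ('m \<Rightarrow> real) \<Rightarrow> 'm \<Rightarrow> real"
    and G :: "'n \<Rightarrow> 'v::euclidean_space \<Rightarrow> 'v" +
  fixes \<omega> t c :: "'n \<Rightarrow> 'n \<Rightarrow> 'n \<Rightarrow> 'm \<Rightarrow> real"
  assumes smooth_\<omega>: "smooth (\<omega> l i j)"
    and smooth_t: "smooth (t i j k)"
    and \<omega>_skew: "q \<in> U \<Longrightarrow> \<omega> l j i q = - \<omega> l i j q"
    and t_alt: "q \<in> U \<Longrightarrow> t j i k q = - t i j k q" "q \<in> U \<Longrightarrow> t i k j q = - t i j k q"
    and t_parallel: "q \<in> U \<Longrightarrow> d l (t i j k) q =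
      (\<Sum>m\<in>UNIV. \<omega> l i m q * t m j k q + \<omega> l j m q * t i m k q + \<omega> l k m q * t i j m q)"
    and torsion: "q \<in> U \<Longrightarrow> c k l m q = \<omega> k l m q - \<omega> l k m q - t k l m q"
    and commutator: "smooth f \<Longrightarrow> q \<in> U \<Longrightarrow>
      d k (d l f) q - d l (d k f) q = (\<Sum>m\<in>UNIV. c k l m q * d m f q)"
    and jacobi: "q \<in> U \<Longrightarrow> d k (c l i m) q + d l (c i k m) q + d i (c k l m) q =
      - (\<Sum>n\<in>UNIV. c l i n q * c k n m q + c i k n q * c l n m q + c k l n q * c i n m q)"
begin

abbreviation tor :: "'m \<Rightarrow> 'v \<Rightarrow> 'v" where
  "tor q \<equiv> act3 (\<lambda>i j k. t i j k q)"

text \<open>The spin lift of the connection: a skew matrix acts on spinors as half of \<open>act2\<close>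
  (see \<open>act2_G\<close>).\<close>

definition nab :: "'n \<Rightarrow> ('m \<Rightarrow> 'v) \<Rightarrow> 'm \<Rightarrow> 'v" where
  "nab l \<psi> q = vd l \<psi> q + (1 / 2) *\<^sub>R act2 (\<lambda>i j. \<omega> l i j q) (\<psi> q)"

lemma vsmooth_act2:
  "(\<And>i j. smooth (b i j)) \<Longrightarrow> vsmooth \<psi> \<Longrightarrow> vsmooth (\<lambda>q. act2 (\<lambda>i j. b i j q) (\<psi> q))"
  unfolding act2_def
  by (intro vsmooth_scaleR smooth_const vsmooth_sum vsmooth_linear[OF linear_G]) auto

lemma vsmooth_act3:
  "(\<And>i j k. smooth (b i j k)) \<Longrightarrow> vsmooth \<psi> \<Longrightarrow> vsmooth (\<lambda>q. act3 (\<lambda>i j k. b i j k q) (\<psi> q))"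
  unfolding act3_def
  by (intro vsmooth_scaleR smooth_const vsmooth_sum vsmooth_linear[OF linear_G]) auto

lemma vsmooth_nab: "vsmooth \<psi> \<Longrightarrow> vsmooth (nab l \<psi>)"
  unfolding nab_def by (intro vsmooth_add vsmooth_vd vsmooth_scaleR vsmooth_act2 smooth_const smooth_\<omega>)

lemma vd_act2:
  assumes b: "\<And>i j. smooth (b i j)" and \<psi>: "vsmooth \<psi>" and p: "p \<in> U"
  shows "vd l (\<lambda>q. act2 (\<lambda>i j. b i j q) (\<psi> q)) p =
    act2 (\<lambda>i j. d l (b i j) p) (\<psi> p) + act2 (\<lambda>i j. b i j p) (vd l \<psi> p)"
proof -
  have GG: "vsmooth (\<lambda>q. G i (G j (\<psi> q)))" for i j
    by (intro vsmooth_linear[OF linear_G] \<psi>)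
  then have S: "vsmooth (\<lambda>q. b i j q *\<^sub>R G i (G j (\<psi> q)))" for i j
    by (intro vsmooth_scaleR b)
  have "vd l (\<lambda>q. b i j q *\<^sub>R G i (G j (\<psi> q))) p =
      d l (b i j) p *\<^sub>R G i (G j (\<psi> p)) + b i j p *\<^sub>R G i (G j (vd l \<psi> p))" for i j
    by (simp add: vd_scaleR[OF b GG p] vd_linear[OF linear_G _ p] vsmooth_linear[OF linear_G] \<psi>)
  then show ?thesis
    unfolding act2_def
    by (simp add: vd_scaleR smooth_const vsmooth_sum S p d_const vd_sum sum.distrib scaleR_add_right)
qed

lemma vd_act3:
  assumes b: "\<And>i j k. smooth (b i j k)" and \<psi>: "vsmooth \<psi>" and p: "p \<in> U"
  shows "vd l (\<lambda>q. act3 (\<lambda>i j k. b i j k q) (\<psi> q)) p =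
    act3 (\<lambda>i j k. d l (b i j k) p) (\<psi> p) + act3 (\<lambda>i j k. b i j k p) (vd l \<psi> p)"
proof -
  have GG: "vsmooth (\<lambda>q. G i (G j (G k (\<psi> q))))" for i j k
    by (intro vsmooth_linear[OF linear_G] \<psi>)
  then have S: "vsmooth (\<lambda>q. b i j k q *\<^sub>R G i (G j (G k (\<psi> q))))" for i j k
    by (intro vsmooth_scaleR b)
  have "vd l (\<lambda>q. b i j k q *\<^sub>R G i (G j (G k (\<psi> q)))) p =
      d l (b i j k) p *\<^sub>R G i (G j (G k (\<psi> p))) + b i j k p *\<^sub>R G i (G j (G k (vd l \<psi> p)))" for i j k
    by (simp add: vd_scaleR[OF b GG p] vd_linear[OF linear_G _ p] vsmooth_linear[OF linear_G] \<psi>)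
  then show ?thesis
    unfolding act3_def
    by (simp add: vd_scaleR smooth_const vsmooth_sum S p d_const vd_sum sum.distrib scaleR_add_right)
qed

lemma nab_cong: "vsmooth \<psi> \<Longrightarrow> (\<And>q. q \<in> U \<Longrightarrow> \<psi> q = \<phi> q) \<Longrightarrow> p \<in> U \<Longrightarrow> nab l \<psi> p = nab l \<phi> p"
  unfolding nab_def using vd_cong[of \<psi> \<phi>] by simp

lemma nab_add: "vsmooth \<psi> \<Longrightarrow> vsmooth \<phi> \<Longrightarrow> p \<in> U \<Longrightarrow>
    nab l (\<lambda>q. \<psi> q + \<phi> q) p = nab l \<psi> p + nab l \<phi> p"
  by (simp add: nab_def vd_add linear_add[OF linear_act2] scaleR_add_right)

lemma nab_scale: "vsmooth \<psi> \<Longrightarrow> p \<in> U \<Longrightarrow> nab l (\<lambda>q. a *\<^sub>R \<psi> q) p = a *\<^sub>R nab l \<psi> p"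
  by (simp add: nab_def vd_scaleR smooth_const d_const linear_scale[OF linear_act2] scaleR_add_right)

lemma nab_sum: "(\<And>a. a \<in> A \<Longrightarrow> vsmooth (\<psi> a)) \<Longrightarrow> p \<in> U \<Longrightarrow>
    nab l (\<lambda>q. \<Sum>a\<in>A. \<psi> a q) p = (\<Sum>a\<in>A. nab l (\<psi> a) p)"
  by (simp add: nab_def vd_sum linear_sum[OF linear_act2] scaleR_right.sum sum.distrib)

text \<open>The product rule for Clifford multiplication by a frame vector,
  \<open>\<nabla>\<^sub>l (e\<^sub>k \<cdot> \<psi>) = e\<^sub>k \<cdot> \<nabla>\<^sub>l \<psi> + (\<nabla>\<^sub>l e\<^sub>k) \<cdot> \<psi>\<close>.\<close>

lemma nab_G:
  assumes \<psi>: "vsmooth \<psi>" and p: "p \<in> U"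
  shows "nab l (\<lambda>q. G k (\<psi> q)) p = G k (nab l \<psi> p) + (\<Sum>m\<in>UNIV. \<omega> l k m p *\<^sub>R G m (\<psi> p))"
  by (simp add: nab_def vd_linear[OF linear_G \<psi> p] act2_G[OF \<omega>_skew[OF p]] G_linear_simps scaleR_add_right)

text \<open>The derivative of the coefficients of \<open>T\<close> and the derivation action of \<open>\<omega>\<close> on its slots
  (\<open>act2_act3\<close>) cancel; this is what \<open>\<nabla>T = 0\<close> means.\<close>

lemma nab_tor:
  assumes \<psi>: "vsmooth \<psi>" and p: "p \<in> U"
  shows "nab l (\<lambda>q. tor q (\<psi> q)) p = tor p (nab l \<psi> p)"
  by (simp add: nab_def vd_act3[OF smooth_t \<psi> p] act2_act3[OF \<omega>_skew[OF p]] t_parallel[OF p]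
      linear_add[OF linear_act3] linear_scale[OF linear_act3] scaleR_diff_right)

text \<open>The components \<open>g(R(e\<^sub>k, e\<^sub>l) e\<^sub>i, e\<^sub>j)\<close> of the curvature of the connection with torsion.\<close>

definition curv :: "'n \<Rightarrow> 'n \<Rightarrow> 'n \<Rightarrow> 'n \<Rightarrow> 'm \<Rightarrow> real" where
  "curv k l i j q = d k (\<omega> l i j) q - d l (\<omega> k i j) q
     + (\<Sum>m\<in>UNIV. \<omega> k m i q * \<omega> l m j q + \<omega> k m j q * \<omega> l i m q - c k l m q * \<omega> m i j q)"

lemma vd_commutator:
  fixes \<psi> :: "'m \<Rightarrow> 'v"
  assumes "vsmooth \<psi>" and "p \<in> U"
  shows "vd k (vd l \<psi>) p = vd l (vd k \<psi>) p + (\<Sum>m\<in>UNIV. c k l m p *\<^sub>R vd m \<psi> p)"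
proof (rule euclidean_eqI)
  fix b :: 'v assume b: "b \<in> Basis"
  show "vd k (vd l \<psi>) p \<bullet> b = (vd l (vd k \<psi>) p + (\<Sum>m\<in>UNIV. c k l m p *\<^sub>R vd m \<psi> p)) \<bullet> b"
    using commutator[of "\<lambda>q. \<psi> q \<bullet> b" p k l] assms b
    by (simp add: vd_inner inner_add_left inner_sum_left vsmooth_def)
qed

lemma nab_nab:
  assumes \<psi>: "vsmooth \<psi>" and p: "p \<in> U"
  shows "nab k (nab l \<psi>) p = vd k (vd l \<psi>) p + (1 / 2) *\<^sub>R act2 (\<lambda>i j. d k (\<omega> l i j) p) (\<psi> p)
    + (1 / 2) *\<^sub>R act2 (\<lambda>i j. \<omega> l i j p) (vd k \<psi> p)
    + (1 / 2) *\<^sub>R act2 (\<lambda>i j. \<omega> k i j p) (vd l \<psi> p)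
    + (1 / 4) *\<^sub>R act2 (\<lambda>i j. \<omega> k i j p) (act2 (\<lambda>i j. \<omega> l i j p) (\<psi> p))"
proof -
  have S: "vsmooth (\<lambda>q. act2 (\<lambda>i j. \<omega> l i j q) (\<psi> q))"
    by (intro vsmooth_act2 smooth_\<omega> \<psi>)
  show ?thesis
    unfolding nab_def
    by (simp add: vd_add vsmooth_vd \<psi> vsmooth_scaleR smooth_const S p vd_scaleR d_const
        vd_act2[OF smooth_\<omega> \<psi> p] linear_add[OF linear_act2] linear_scale[OF linear_act2] scaleR_add_right)
qed

text \<open>The curvature of the spinor bundle is the image of the curvature of the connection under the
  spin representation, because the latter respects commutators (\<open>act2_act2\<close>).\<close>

lemma nab_commutator:
  assumes \<psi>: "vsmooth \<psi>" and p: "p \<in> U"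
  shows "nab k (nab l \<psi>) p - nab l (nab k \<psi>) p - (\<Sum>m\<in>UNIV. c k l m p *\<^sub>R nab m \<psi> p) =
    (1 / 2) *\<^sub>R act2 (\<lambda>i j. curv k l i j p) (\<psi> p)"
proof -
  have "act2 (\<lambda>i j. curv k l i j p) (\<psi> p) =
      act2 (\<lambda>i j. d k (\<omega> l i j) p) (\<psi> p) - act2 (\<lambda>i j. d l (\<omega> k i j) p) (\<psi> p)
      + act2 (\<lambda>i j. \<Sum>m\<in>UNIV. \<omega> k m i p * \<omega> l m j p + \<omega> k m j p * \<omega> l i m p) (\<psi> p)
      - (\<Sum>m\<in>UNIV. c k l m p *\<^sub>R act2 (\<lambda>i j. \<omega> m i j p) (\<psi> p))"
    unfolding curv_def by (simp add: act2_add act2_diff act2_sum act2_scale sum_subtractf)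
  moreover have "act2 (\<lambda>i j. \<omega> k i j p) (act2 (\<lambda>i j. \<omega> l i j p) (\<psi> p)) =
      act2 (\<lambda>i j. \<omega> l i j p) (act2 (\<lambda>i j. \<omega> k i j p) (\<psi> p))
      + 2 *\<^sub>R act2 (\<lambda>i j. \<Sum>m\<in>UNIV. \<omega> k m i p * \<omega> l m j p + \<omega> k m j p * \<omega> l i m p) (\<psi> p)"
    by (rule act2_act2[OF \<omega>_skew[OF p]])
  ultimately show ?thesis
    by (simp add: nab_nab[OF \<psi> p] vd_commutator[OF \<psi> p, of k l]
        nab_def[of _ \<psi>] scaleR_add_right scaleR_diff_right sum.distrib scaleR_right.sum)
qed

lemma c_skew: "q \<in> U \<Longrightarrow> c l k m q = - c k l m q"
  using t_alt(1)[of q l k m] by (simp add: torsion)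

lemma curv_skew_plane:
  assumes p: "p \<in> U"
  shows "curv l k i j p = - curv k l i j p"
proof -
  have "\<omega> l m i p * \<omega> k m j p + \<omega> l m j p * \<omega> k i m p - c l k m p * \<omega> m i j p =
      - (\<omega> k m i p * \<omega> l m j p + \<omega> k m j p * \<omega> l i m p - c k l m p * \<omega> m i j p)" for m
    using \<omega>_skew[OF p, of k i m] \<omega>_skew[OF p, of l i m] c_skew[OF p, of l k m] by simp
  then show ?thesis
    by (simp add: curv_def sum_negf del: minus_add_distrib minus_diff_eq)
qed

lemma curv_skew_endo:
  assumes p: "p \<in> U"
  shows "curv k l j i p = - curv k l i j p"
proof -
  have dw: "d k (\<omega> l j i) p = - d k (\<omega> l i j) p" for k l
  proof -
    have "d k (\<omega> l j i) p = d k (\<lambda>q. - 1 * \<omega> l i j q) p"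
      using p by (intro d_cong smooth_\<omega>) (simp add: \<omega>_skew[of _ l j i])
    then show ?thesis
      by (simp only: d_cmult[OF smooth_\<omega> p])
  qed
  have "\<omega> k m j p * \<omega> l m i p + \<omega> k m i p * \<omega> l j m p - c k l m p * \<omega> m j i p =
      - (\<omega> k m i p * \<omega> l m j p + \<omega> k m j p * \<omega> l i m p - c k l m p * \<omega> m i j p)" for m
    using \<omega>_skew[OF p, of l i m] \<omega>_skew[OF p, of l j m] \<omega>_skew[OF p, of m j i] by simp
  then show ?thesis
    by (simp add: curv_def dw sum_negf del: minus_add_distrib minus_diff_eq)
qed

lemma d_structure_functions:
  assumes p: "p \<in> U"
  shows "d i (c k l m) p = d i (\<omega> k l m) p - d i (\<omega> l k m) p - d i (t k l m) p"
proof -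
  have "d i (c k l m) p = d i (\<lambda>q. \<omega> k l m q - \<omega> l k m q - t k l m q) p"
    using p by (intro d_cong[symmetric] smooth_diff smooth_\<omega> smooth_t) (auto simp: torsion)
  then show ?thesis
    by (simp add: d_diff smooth_diff smooth_\<omega> smooth_t p)
qed

text \<open>The first Bianchi identity for parallel skew torsion. Replacing \<open>\<omega>\<^bsub>lij\<^esub> - \<omega>\<^bsub>ilj\<^esub>\<close> by \<open>c\<^bsub>lij\<^esub> + t\<^bsub>lij\<^esub>\<close>
  in the cyclic sum leaves the derivatives of \<open>c\<close>, given by the Jacobi identity, and those of \<open>t\<close>,
  given by parallelism. What remains is an identity between products, valid for every value of the
  summation index, in which all terms containing \<open>\<omega>\<close> cancel.\<close>

lemma bianchi:
  assumes p: "p \<in> U"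
  shows "curv k l i j p + curv l i k j p + curv i k l j p =
    (\<Sum>n\<in>UNIV. t l i n p * t k j n p + t i k n p * t l j n p + t k l n p * t i j n p)"
proof -
  define Q where "Q k l i n = \<omega> k n i p * \<omega> l n j p + \<omega> k n j p * \<omega> l i n p - c k l n p * \<omega> n i j p" for k l i n
  define P where "P l i k n = \<omega> l i n p * t n k j p + \<omega> l k n p * t i n j p + \<omega> l j n p * t i k n p" for l i k n
  have "curv k l i j p + curv l i k j p + curv i k l j p =
      (d k (c l i j) p + d l (c i k j) p + d i (c k l j) p)
      + (d k (t l i j) p + d l (t i k j) p + d i (t k l j) p)
      + (\<Sum>n\<in>UNIV. Q k l i n) + (\<Sum>n\<in>UNIV. Q l i k n) + (\<Sum>n\<in>UNIV. Q i k l n)"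
    by (simp add: curv_def d_structure_functions[OF p] Q_def)
  also have "\<dots> = (\<Sum>n\<in>UNIV. (P k l i n + P l i k n + P i k l n) + Q k l i n + Q l i k n + Q i k l n
      - (c l i n p * c k n j p + c i k n p * c l n j p + c k l n p * c i n j p))"
    by (simp add: jacobi[OF p] t_parallel[OF p] P_def sum.distrib sum_subtractf)
  also have "\<dots> = (\<Sum>n\<in>UNIV. t l i n p * t k j n p + t i k n p * t l j n p + t k l n p * t i j n p)"
  proof (rule sum.cong[OF refl])
    fix n
    \<comment> \<open>A normal form for the monomials: the summation index goes last, the other indices of \<open>t\<close> are sorted.\<close>
    have n: "t n a b p = t a b n p" "t a n b p = - t a b n p" "\<omega> a n b p = - \<omega> a b n p" for a b
      using t_alt[OF p] \<omega>_skew[OF p] by (metis minus_minus)+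
    have s: "t l k n p = - t k l n p" "t i k n p = - t k i n p" "t i l n p = - t l i n p"
      by (rule t_alt(1)[OF p])+
    show "(P k l i n + P l i k n + P i k l n) + Q k l i n + Q l i k n + Q i k l n
      - (c l i n p * c k n j p + c i k n p * c l n j p + c k l n p * c i n j p) =
      t l i n p * t k j n p + t i k n p * t l j n p + t k l n p * t i j n p"
      unfolding P_def Q_def torsion[OF p]
      by (simp only: n s) (simp add: algebra_simps)
  qed
  finally show ?thesis .
qed

text \<open>The classical octahedron argument: add the cyclic identities that start from the four cyclic
  shifts of \<open>(k, l, i, j)\<close>. A \<open>4\<close>-cycle is an odd permutation, so the right hand sides, being values
  of a \<open>4\<close>-form, add up to zero, exactly as for a torsion-free connection.\<close>

lemma pair_symmetry:
  assumes p: "p \<in> U"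
  shows "curv k l i j p = curv i j k l p"
proof -
  define S where "S k l i j =
    (\<Sum>n\<in>UNIV. t l i n p * t k j n p + t i k n p * t l j n p + t k l n p * t i j n p)" for k l i j
  have b: "curv k l i j p + curv l i k j p + curv i k l j p = S k l i j" for k l i j
    unfolding S_def by (rule bianchi[OF p])
  have S: "S l i j k = - S k l i j" for k l i j
    unfolding S_def sum_negf[symmetric]
  proof (rule sum.cong[OF refl])
    fix n
    have s: "t l k n p = - t k l n p" "t i k n p = - t k i n p" "t i l n p = - t l i n p"
      "t j k n p = - t k j n p" "t j l n p = - t l j n p" "t j i n p = - t i j n p"
      by (rule t_alt(1)[OF p])+
    show "t i j n p * t l k n p + t j l n p * t i k n p + t l i n p * t j k n p =
      - (t l i n p * t k j n p + t i k n p * t l j n p + t k l n p * t i j n p)"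
      by (simp only: s) (simp add: algebra_simps)
  qed
  note c1 = curv_skew_plane[OF p] and c2 = curv_skew_endo[OF p]
  \<comment> \<open>All terms of the sum cancel in pairs except \<open>R\<^bsub>iklj\<^esub>\<close> and \<open>R\<^bsub>jlik\<^esub>\<close>, which occur twice.\<close>
  have "curv i k l j p = curv l j i k p" for k l i j
    using b[of k l i j] b[of l i j k] b[of i j k l] b[of j k l i]
      S[of l i j k] S[of i j k l] S[of j k l i]
      c2[of k l j i] c2[of l i j k] c2[of i j l k] c2[of j k l i]
      c1[of k i j l] c2[of i k j l] c1[of l j k i] c2[of j l k i] c1[of j l i k]
    by linarith
  then show ?thesis .
qed

lemma nab_nab_tor:
  assumes \<psi>: "vsmooth \<psi>" and p: "p \<in> U"
  shows "nab k (nab l (\<lambda>q. tor q (\<psi> q))) p = tor p (nab k (nab l \<psi>) p)"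
proof -
  have T\<psi>: "vsmooth (\<lambda>q. tor q (\<psi> q))"
    by (intro vsmooth_act3 smooth_t \<psi>)
  have "nab k (nab l (\<lambda>q. tor q (\<psi> q))) p = nab k (\<lambda>q. tor q (nab l \<psi> q)) p"
    by (rule nab_cong[OF vsmooth_nab[OF T\<psi>] _ p]) (rule nab_tor[OF \<psi>])
  then show ?thesis
    by (simp add: nab_tor vsmooth_nab \<psi> p)
qed

text \<open>At a single point the curvature is a commutator of covariant derivatives only when it is applied
  to a spinor field, so the given spinor is extended as a constant.\<close>

lemma curv_tor:
  assumes p: "p \<in> U"
  shows "act2 (\<lambda>i j. curv k l i j p) (tor p x) = tor p (act2 (\<lambda>i j. curv k l i j p) x)"
proof -
  define \<psi> where "\<psi> = (\<lambda>q::'m. x)"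
  have \<psi>: "vsmooth \<psi>"
    by (simp add: \<psi>_def vsmooth_const)
  have T\<psi>: "vsmooth (\<lambda>q. tor q (\<psi> q))"
    by (intro vsmooth_act3 smooth_t \<psi>)
  interpret linear "tor p" by (rule linear_act3)
  have "(1 / 2) *\<^sub>R act2 (\<lambda>i j. curv k l i j p) (tor p (\<psi> p)) =
      nab k (nab l (\<lambda>q. tor q (\<psi> q))) p - nab l (nab k (\<lambda>q. tor q (\<psi> q))) p
      - (\<Sum>m\<in>UNIV. c k l m p *\<^sub>R nab m (\<lambda>q. tor q (\<psi> q)) p)"
    by (rule nab_commutator[OF T\<psi> p, symmetric])
  also have "\<dots> = tor p (nab k (nab l \<psi>) p - nab l (nab k \<psi>) p - (\<Sum>m\<in>UNIV. c k l m p *\<^sub>R nab m \<psi> p))"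
    by (simp add: nab_nab_tor[OF \<psi> p] nab_tor[OF \<psi> p] diff sum scale)
  also have "\<dots> = tor p ((1 / 2) *\<^sub>R act2 (\<lambda>i j. curv k l i j p) (\<psi> p))"
    by (rule arg_cong[OF nab_commutator[OF \<psi> p]])
  also have "\<dots> = (1 / 2) *\<^sub>R tor p (act2 (\<lambda>i j. curv k l i j p) (\<psi> p))"
    by (rule scale)
  finally show ?thesis
    by (simp only: scaleR_cancel_left \<psi>_def) simp
qed

definition curv_endo :: "'m \<Rightarrow> 'v \<Rightarrow> 'v" where
  "curv_endo p x = (\<Sum>k\<in>UNIV. \<Sum>l\<in>UNIV. G k (G l (act2 (\<lambda>i j. curv k l i j p) x)))"

text \<open>Written out, both sides are sums of \<open>\<onehalf> R\<^bsub>klij\<^esub> e\<^sub>k e\<^sub>l L e\<^sub>i e\<^sub>j\<close>. The pair symmetry decides which of the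
  two pairs of generators is absorbed into the curvature action; with \<open>L\<close> the torsion form, this is
  what moves it through first one and then the other pair.\<close>

lemma curv_contraction_swap:
  assumes p: "p \<in> U" and L: "linear L"
  shows "(\<Sum>k\<in>UNIV. \<Sum>l\<in>UNIV. G k (G l (L (act2 (\<lambda>i j. curv k l i j p) x)))) =
    (\<Sum>i\<in>UNIV. \<Sum>j\<in>UNIV. act2 (\<lambda>k l. curv i j k l p) (L (G i (G j x))))"
proof -
  let ?f = "\<lambda>k l i j. curv k l i j p *\<^sub>R G k (G l (L (G i (G j x))))"
  have "(\<Sum>k\<in>UNIV. \<Sum>l\<in>UNIV. G k (G l (L (act2 (\<lambda>i j. curv k l i j p) x)))) =
      (1 / 2) *\<^sub>R (\<Sum>k\<in>UNIV. \<Sum>l\<in>UNIV. \<Sum>i\<in>UNIV. \<Sum>j\<in>UNIV. ?f k l i j)"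
    by (simp add: act2_def linear_scale[OF L] linear_sum[OF L] G_linear_simps scaleR_right.sum)
  also have "(\<Sum>k\<in>UNIV. \<Sum>l\<in>UNIV. \<Sum>i\<in>UNIV. \<Sum>j\<in>UNIV. ?f k l i j) =
      (\<Sum>(k,l,i,j)\<in>UNIV. ?f k l i j)"
    by (simp add: sum.cartesian_product)
  also have "\<dots> = (\<Sum>(i,j,k,l)\<in>UNIV. ?f k l i j)"
    by (rule sum.reindex_bij_witness[where i="\<lambda>(i,j,k,l). (k,l,i,j)" and j="\<lambda>(i,j,k,l). (k,l,i,j)"]) auto
  also have "\<dots> = (\<Sum>i\<in>UNIV. \<Sum>j\<in>UNIV. \<Sum>k\<in>UNIV. \<Sum>l\<in>UNIV. ?f k l i j)"
    by (simp add: sum.cartesian_product)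
  finally show ?thesis
    unfolding act2_def scaleR_right.sum[symmetric] by (subst pair_symmetry[OF p])
qed

lemma curv_endo_tor:
  assumes p: "p \<in> U"
  shows "curv_endo p (tor p x) = tor p (curv_endo p x)"
proof -
  interpret linear "tor p" by (rule linear_act3)
  have "curv_endo p (tor p x) = (\<Sum>k\<in>UNIV. \<Sum>l\<in>UNIV. G k (G l (tor p (act2 (\<lambda>i j. curv k l i j p) x))))"
    by (simp add: curv_endo_def curv_tor[OF p])
  also have "\<dots> = (\<Sum>i\<in>UNIV. \<Sum>j\<in>UNIV. act2 (\<lambda>k l. curv i j k l p) (tor p (G i (G j x))))"
    by (rule curv_contraction_swap[OF p linear_act3])
  also have "\<dots> = tor p (\<Sum>i\<in>UNIV. \<Sum>j\<in>UNIV. act2 (\<lambda>k l. curv i j k l p) (G i (G j x)))"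
    by (simp only: curv_tor[OF p] sum)
  also have "\<dots> = tor p (curv_endo p x)"
    using curv_contraction_swap[OF p linear_id, of x] by (simp only: curv_endo_def id_apply)
  finally show ?thesis .
qed

text \<open>The second covariant derivative \<open>\<nabla>\<^sub>k \<nabla>\<^sub>l - \<nabla>\<^bsub>\<nabla>\<^sub>k e\<^sub>l\<^esub>\<close>. Minus its trace, called \<open>lap\<close> below, is the
  spinor Laplacian \<open>\<nabla>\<^sup>*\<nabla>\<close>.\<close>

definition hess :: "'n \<Rightarrow> 'n \<Rightarrow> ('m \<Rightarrow> 'v) \<Rightarrow> 'm \<Rightarrow> 'v" where
  "hess k l \<psi> p = nab k (nab l \<psi>) p - (\<Sum>m\<in>UNIV. \<omega> k l m p *\<^sub>R nab m \<psi> p)"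

definition lap :: "('m \<Rightarrow> 'v) \<Rightarrow> 'm \<Rightarrow> 'v" where
  "lap \<psi> p = - (\<Sum>k\<in>UNIV. hess k k \<psi> p)"

lemma hess_tor:
  assumes \<psi>: "vsmooth \<psi>" and p: "p \<in> U"
  shows "hess k l (\<lambda>q. tor q (\<psi> q)) p = tor p (hess k l \<psi> p)"
proof -
  interpret linear "tor p" by (rule linear_act3)
  show ?thesis
    by (simp add: hess_def nab_tor[OF \<psi> p] nab_nab_tor[OF \<psi> p] diff sum scale)
qed

lemma hess_commutator:
  assumes \<psi>: "vsmooth \<psi>" and p: "p \<in> U"
  shows "hess k l \<psi> p - hess l k \<psi> p =
    (1 / 2) *\<^sub>R act2 (\<lambda>i j. curv k l i j p) (\<psi> p) - (\<Sum>m\<in>UNIV. t k l m p *\<^sub>R nab m \<psi> p)"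
  unfolding nab_commutator[OF \<psi> p, symmetric] hess_def torsion[OF p]
  by (simp add: scaleR_diff_left sum_subtractf)

definition dirac_op :: "('m \<Rightarrow> 'v) \<Rightarrow> 'm \<Rightarrow> 'v" where
  "dirac_op \<psi> p = (\<Sum>l\<in>UNIV. G l (nab l \<psi> p))"

lemma vsmooth_dirac_op: "vsmooth \<psi> \<Longrightarrow> vsmooth (dirac_op \<psi>)"
  unfolding dirac_op_def by (intro vsmooth_sum vsmooth_linear[OF linear_G] vsmooth_nab)

text \<open>The symmetric part of \<open>H\<close> contracts with the Clifford relation to minus the trace, the skew part
  is kept.\<close>

lemma clifford_contraction:
  "(\<Sum>k\<in>UNIV. \<Sum>l\<in>UNIV. G k (G l (H k l))) =
     - (\<Sum>k\<in>UNIV. H k k) + (1 / 2) *\<^sub>R (\<Sum>k\<in>UNIV. \<Sum>l\<in>UNIV. G k (G l (H k l - H l k)))"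
proof -
  let ?s = "\<lambda>f. \<Sum>k\<in>UNIV. \<Sum>l\<in>UNIV. f k l"
  have "2 *\<^sub>R ?s (\<lambda>k l. G k (G l (H k l))) = ?s (\<lambda>k l. G k (G l (H k l))) + ?s (\<lambda>k l. G l (G k (H l k)))"
    by (subst (3) sum.swap) (simp add: scaleR_2)
  also have "\<dots> = ?s (\<lambda>k l. G k (G l (H l k)) + G l (G k (H l k))) + ?s (\<lambda>k l. G k (G l (H k l - H l k)))"
    by (simp add: G_linear_simps sum.distrib sum_subtractf)
  also have "?s (\<lambda>k l. G k (G l (H l k)) + G l (G k (H l k))) = ?s (\<lambda>k l. if k = l then - 2 *\<^sub>R H l k else 0)"
    by (intro sum.cong refl) (simp only: clifford, simp)
  also have "\<dots> = - 2 *\<^sub>R (\<Sum>k\<in>UNIV. H k k)"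
    by (simp add: scaleR_right.sum sum_negf)
  finally have "(1 / 2) *\<^sub>R 2 *\<^sub>R ?s (\<lambda>k l. G k (G l (H k l))) =
    (1 / 2) *\<^sub>R (- 2 *\<^sub>R (\<Sum>k\<in>UNIV. H k k) + ?s (\<lambda>k l. G k (G l (H k l - H l k))))"
    by (rule arg_cong)
  then show ?thesis
    by (simp add: scaleR_diff_right)
qed

lemma dirac_op_sq_hess:
  assumes \<psi>: "vsmooth \<psi>" and p: "p \<in> U"
  shows "dirac_op (dirac_op \<psi>) p = (\<Sum>k\<in>UNIV. \<Sum>l\<in>UNIV. G k (G l (hess k l \<psi> p)))"
proof -
  have "nab k (dirac_op \<psi>) p = (\<Sum>l\<in>UNIV. G l (hess k l \<psi> p))" for k
  proof -
    have "nab k (dirac_op \<psi>) p = (\<Sum>l\<in>UNIV. nab k (\<lambda>q. G l (nab l \<psi> q)) p)"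
      unfolding dirac_op_def by (intro nab_sum vsmooth_linear[OF linear_G] vsmooth_nab \<psi> p)
    also have "\<dots> = (\<Sum>l\<in>UNIV. G l (nab k (nab l \<psi>) p)) + (\<Sum>l\<in>UNIV. \<Sum>m\<in>UNIV. \<omega> k l m p *\<^sub>R G m (nab l \<psi> p))"
      by (simp add: nab_G vsmooth_nab \<psi> p sum.distrib)
    also have "(\<Sum>l\<in>UNIV. \<Sum>m\<in>UNIV. \<omega> k l m p *\<^sub>R G m (nab l \<psi> p)) =
        (\<Sum>l\<in>UNIV. \<Sum>m\<in>UNIV. \<omega> k m l p *\<^sub>R G l (nab m \<psi> p))"
      by (rule sum.swap)
    also have "\<dots> = (\<Sum>l\<in>UNIV. - G l (\<Sum>m\<in>UNIV. \<omega> k l m p *\<^sub>R nab m \<psi> p))"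
    proof (rule sum.cong[OF refl])
      fix l
      show "(\<Sum>m\<in>UNIV. \<omega> k m l p *\<^sub>R G l (nab m \<psi> p)) = - G l (\<Sum>m\<in>UNIV. \<omega> k l m p *\<^sub>R nab m \<psi> p)"
        by (simp add: G_linear_simps \<omega>_skew[OF p, of k l] sum_negf)
    qed
    finally show ?thesis
      by (simp add: hess_def G_linear_simps sum_negf sum_subtractf)
  qed
  then show ?thesis
    by (simp add: dirac_op_def[of "dirac_op \<psi>"] G_linear_simps)
qed

text \<open>A Lichnerowicz formula in which the curvature term is left unevaluated.\<close>

lemma dirac_op_sq:
  assumes \<psi>: "vsmooth \<psi>" and p: "p \<in> U"
  shows "dirac_op (dirac_op \<psi>) p =
    lap \<psi> p + (1 / 4) *\<^sub>R curv_endo p (\<psi> p) - (\<Sum>m\<in>UNIV. act2 (\<lambda>i j. t m i j p) (nab m \<psi> p))"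
proof -
  have cyc: "t k l m p = t m k l p" for k l m
    using t_alt[OF p] by (metis minus_minus)
  have "(\<Sum>k\<in>UNIV. \<Sum>l\<in>UNIV. G k (G l (\<Sum>m\<in>UNIV. t k l m p *\<^sub>R nab m \<psi> p))) =
      (\<Sum>k\<in>UNIV. \<Sum>l\<in>UNIV. \<Sum>m\<in>UNIV. t m k l p *\<^sub>R G k (G l (nab m \<psi> p)))"
    by (simp only: G_linear_simps) (subst cyc, rule refl)
  also have "\<dots> = (\<Sum>k\<in>UNIV. \<Sum>m\<in>UNIV. \<Sum>l\<in>UNIV. t m k l p *\<^sub>R G k (G l (nab m \<psi> p)))"
    by (intro sum.cong refl sum.swap)
  also have "\<dots> = 2 *\<^sub>R (\<Sum>m\<in>UNIV. act2 (\<lambda>i j. t m i j p) (nab m \<psi> p))"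
    by (subst sum.swap) (simp add: act2_def scaleR_right.sum)
  finally show ?thesis
    unfolding dirac_op_sq_hess[OF \<psi> p]
    by (subst clifford_contraction)
      (simp add: hess_commutator[OF \<psi> p] G_linear_simps sum_subtractf lap_def curv_endo_def
        scaleR_diff_right scaleR_right.sum)
qed

text \<open>The coefficient comes from \<open>D = D\<^sup>g + \<threequarters> T\<close> and \<open>D\<^bsup>1/3\<^esup> = D\<^sup>g + \<onequarter> T\<close>, with \<open>D\<close> the Dirac operator
  of the connection with torsion \<open>T\<close>.\<close>

definition dirac_third_op :: "('m \<Rightarrow> 'v) \<Rightarrow> 'm \<Rightarrow> 'v" where
  "dirac_third_op \<psi> p = dirac_op \<psi> p - (1 / 2) *\<^sub>R tor p (\<psi> p)"

text \<open>The anticommutator of \<open>D\<close> with \<open>T\<close> cancels the first order term of \<open>D\<^sup>2\<close>.\<close>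

lemma dirac_third_op_sq:
  assumes \<psi>: "vsmooth \<psi>" and p: "p \<in> U"
  shows "dirac_third_op (dirac_third_op \<psi>) p =
    lap \<psi> p + (1 / 4) *\<^sub>R curv_endo p (\<psi> p) + (1 / 4) *\<^sub>R tor p (tor p (\<psi> p))"
proof -
  interpret linear "tor p" by (rule linear_act3)
  have T\<psi>: "vsmooth (\<lambda>q. tor q (\<psi> q))"
    by (intro vsmooth_act3 smooth_t \<psi>)
  have "nab l (dirac_third_op \<psi>) p = nab l (dirac_op \<psi>) p - (1 / 2) *\<^sub>R tor p (nab l \<psi> p)" for l
  proof -
    have "nab l (dirac_third_op \<psi>) p = nab l (\<lambda>q. dirac_op \<psi> q + (- 1 / 2) *\<^sub>R tor q (\<psi> q)) p"
      by (simp add: dirac_third_op_def[abs_def])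
    also have "\<dots> = nab l (dirac_op \<psi>) p + (- 1 / 2) *\<^sub>R tor p (nab l \<psi> p)"
      by (simp only: nab_add[OF vsmooth_dirac_op[OF \<psi>] vsmooth_scaleR[OF smooth_const T\<psi>] p]
          nab_scale[OF T\<psi> p] nab_tor[OF \<psi> p])
    finally show ?thesis
      by simp
  qed
  then have "dirac_third_op (dirac_third_op \<psi>) p =
      dirac_op (dirac_op \<psi>) p - (1 / 2) *\<^sub>R (\<Sum>l\<in>UNIV. G l (tor p (nab l \<psi> p)) + tor p (G l (nab l \<psi> p)))
      + (1 / 4) *\<^sub>R tor p (tor p (\<psi> p))"
    by (simp add: dirac_third_op_def dirac_op_def[of "dirac_third_op \<psi>"] dirac_op_def[of "dirac_op \<psi>"]
        dirac_op_def[of \<psi> p] G_linear_simps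
        diff sum scale sum_subtractf sum.distrib scaleR_right.sum scaleR_add_right scaleR_diff_right)
  also have "(\<Sum>l\<in>UNIV. G l (tor p (nab l \<psi> p)) + tor p (G l (nab l \<psi> p))) =
      - 2 *\<^sub>R (\<Sum>m\<in>UNIV. act2 (\<lambda>i j. t m i j p) (nab m \<psi> p))"
    by (simp only: act3_anticommutator[of "\<lambda>i j k. t i j k p", OF t_alt[OF p]] scaleR_right.sum)
  finally show ?thesis
    by (simp add: dirac_op_sq[OF \<psi> p])
qed

lemma vsmooth_dirac_third_op: "vsmooth \<psi> \<Longrightarrow> vsmooth (dirac_third_op \<psi>)"
proof -
  assume \<psi>: "vsmooth \<psi>"
  have "vsmooth (\<lambda>q. dirac_op \<psi> q + (- 1 / 2) *\<^sub>R tor q (\<psi> q))"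
    by (intro vsmooth_add vsmooth_dirac_op vsmooth_scaleR smooth_const vsmooth_act3 smooth_t \<psi>)
  then show ?thesis
    by (simp add: dirac_third_op_def[abs_def])
qed

lemma dirac_third_op_cong:
  "vsmooth \<psi> \<Longrightarrow> (\<And>q. q \<in> U \<Longrightarrow> \<psi> q = \<phi> q) \<Longrightarrow> p \<in> U \<Longrightarrow> dirac_third_op \<psi> p = dirac_third_op \<phi> p"
  using nab_cong[of \<psi> \<phi> p] by (simp add: dirac_third_op_def dirac_op_def)

lemma dirac_third_op_sq_tor:
  assumes \<psi>: "vsmooth \<psi>" and p: "p \<in> U"
  shows "dirac_third_op (dirac_third_op (\<lambda>q. tor q (\<psi> q))) p = tor p (dirac_third_op (dirac_third_op \<psi>) p)"
proof -
  interpret linear "tor p" by (rule linear_act3)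
  have T\<psi>: "vsmooth (\<lambda>q. tor q (\<psi> q))"
    by (intro vsmooth_act3 smooth_t \<psi>)
  show ?thesis
    by (simp add: dirac_third_op_sq \<psi> T\<psi> p curv_endo_tor hess_tor lap_def add diff scale neg sum)
qed

end

section \<open>Smooth functions and tangent vectors\<close>

lemma Ck_on_cong:
  assumes S: "open S" and eq: "\<And>x. x \<in> S \<Longrightarrow> f x = h x"
  shows "Ck_on k S f \<longleftrightarrow> Ck_on k S h"
  using eq
proof (induction k arbitrary: f h)
  case 0
  then show ?case by (simp cong: continuous_on_cong)
next
  case (Suc k)
  have diff: "f differentiable (at x) \<longleftrightarrow> h differentiable (at x)" if "x \<in> S" for x
    using Suc.prems S that unfolding differentiable_def
    by (metis has_derivative_transform_within_open)
  have "frechet_derivative f (at x) = frechet_derivative h (at x)" if "x \<in> S" for x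
  proof (cases "f differentiable (at x)")
    case True
    then show ?thesis
      by (rule frechet_derivative_transform_within_open[OF _ S that Suc.prems])
  next
    case False
    with diff[OF that] have "\<not> h differentiable (at x)" by simp
    with False show ?thesis
      by (simp add: frechet_derivative_def differentiable_def)
  qed
  then show ?case
    using diff Suc.IH[of "\<lambda>x. frechet_derivative f (at x) v" "\<lambda>x. frechet_derivative h (at x) v" for v]
    by simp
qed

lemma Ck_on_subset: "Ck_on k S f \<Longrightarrow> S' \<subseteq> S \<Longrightarrow> Ck_on k S' f"
  by (induction k arbitrary: f) (auto intro: continuous_on_subset)

lemma Ck_on_Suc_imp: "Ck_on (Suc k) S f \<Longrightarrow> Ck_on k S f"
proof (induction k arbitrary: f)
  case 0
  then show ?case
    by (auto intro!: continuous_at_imp_continuous_on differentiable_imp_continuous_within)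
next
  case (Suc k)
  from Suc.prems have "\<forall>x\<in>S. f differentiable (at x)"
    and "Ck_on (Suc k) S (\<lambda>x. frechet_derivative f (at x) v)" for v
    using Ck_on.simps(2)[of "Suc k" S f] by blast+
  with Suc.IH show ?case
    using Ck_on.simps(2)[of k S f] by blast
qed

lemma Ck_on_const: "Ck_on k S (\<lambda>x. a)"
  by (induction k arbitrary: a) simp_all

lemma Ck_on_add:
  assumes "open S" "Ck_on k S f" "Ck_on k S h"
  shows "Ck_on k S (\<lambda>x. f x + h x)"
  using assms(2,3)
proof (induction k arbitrary: f h)
  case 0
  then show ?case by (simp add: continuous_on_add)
next
  case (Suc k)
  have "Ck_on k S (\<lambda>x. frechet_derivative (\<lambda>x. f x + h x) (at x) v)" for v
  proof -
    have "Ck_on k S (\<lambda>x. frechet_derivative f (at x) v + frechet_derivative h (at x) v)"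
      using Suc by simp
    moreover have "frechet_derivative (\<lambda>x. f x + h x) (at x) =
        (\<lambda>v. frechet_derivative f (at x) v + frechet_derivative h (at x) v)" if "x \<in> S" for x
      using Suc.prems that
      by (intro frechet_derivative_at[symmetric] has_derivative_add) (simp_all flip: frechet_derivative_works)
    ultimately show ?thesis
      by (subst Ck_on_cong[OF assms(1)]) simp_all
  qed
  with Suc.prems show ?case by simp
qed

lemma Ck_on_mult:
  fixes f h :: "'a::real_normed_vector \<Rightarrow> real"
  assumes "open S" "Ck_on k S f" "Ck_on k S h"
  shows "Ck_on k S (\<lambda>x. f x * h x)"
  using assms(2,3)
proof (induction k arbitrary: f h)
  case 0
  then show ?case by (simp add: continuous_on_mult)
next
  case (Suc k)
  note lower = Suc.prems[THEN Ck_on_Suc_imp]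
  have "Ck_on k S (\<lambda>x. frechet_derivative (\<lambda>x. f x * h x) (at x) v)" for v
  proof -
    have "Ck_on k S (\<lambda>x. f x * frechet_derivative h (at x) v + frechet_derivative f (at x) v * h x)"
      using Suc lower by (intro Ck_on_add[OF assms(1)] Suc.IH) simp_all
    moreover have "frechet_derivative (\<lambda>x. f x * h x) (at x) =
        (\<lambda>v. f x * frechet_derivative h (at x) v + frechet_derivative f (at x) v * h x)" if "x \<in> S" for x
      using Suc.prems that
      by (intro frechet_derivative_at[symmetric] has_derivative_mult) (simp_all flip: frechet_derivative_works)
    ultimately show ?thesis
      by (subst Ck_on_cong[OF assms(1)]) simp_all
  qed
  with Suc.prems show ?case by simp
qed

context
  fixes A :: "('m::topological_space, 'n::finite) atlas"
  assumes atlas: "smooth_atlas A"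
begin

text \<open>Charts map open subsets of their domain to open sets, where derivatives depend only on the values
  in the set.\<close>

lemma chart_open_image:
  assumes "(V, \<phi>) \<in> A" "open N"
  shows "open (\<phi> ` (N \<inter> V))" "inj_on \<phi> V"
proof -
  from assms(1) atlas have o: "open V" "open (\<phi> ` V)" and h: "homeomorphism V (\<phi> ` V) \<phi> (inv_into V \<phi>)"
    by (auto simp: smooth_atlas_def)
  have "openin (top_of_set V) (N \<inter> V)"
    using assms(2) by (auto simp: openin_open)
  from homeomorphism_imp_open_map[OF h this] show "open (\<phi> ` (N \<inter> V))"
    by (simp add: openin_open_eq[OF o(2)])
  show "inj_on \<phi> V"
    by (rule inj_on_inverseI[of _ "inv_into V \<phi>"]) (rule homeomorphism_apply1[OF h])
qed

lemma smooth_at_obtain: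
  assumes "smooth_at A p f"
  obtains N where "open N" "p \<in> N" "\<And>V \<phi> k. (V, \<phi>) \<in> A \<Longrightarrow> Ck_on k (\<phi> ` (N \<inter> V)) (f \<circ> inv_into V \<phi>)"
  using assms unfolding smooth_at_def Cinf_on_def by blast

lemma smooth_atI:
  assumes "open N" "p \<in> N" "\<And>V \<phi> k. (V, \<phi>) \<in> A \<Longrightarrow> Ck_on k (\<phi> ` (N \<inter> V)) (f \<circ> inv_into V \<phi>)"
  shows "smooth_at A p f"
  using assms unfolding smooth_at_def Cinf_on_def by blast

lemma smooth_at_nbhd:
  assumes "smooth_at A p f"
  shows "\<exists>N. open N \<and> p \<in> N \<and> (\<forall>q\<in>N. smooth_at A q f)"
  using assms unfolding smooth_at_def by blast

lemma smooth_at_cong: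
  assumes "smooth_at A p f" "open W" "p \<in> W" "\<And>q. q \<in> W \<Longrightarrow> f q = h q"
  shows "smooth_at A p h"
proof -
  obtain N where N: "open N" "p \<in> N" "\<And>V \<phi> k. (V, \<phi>) \<in> A \<Longrightarrow> Ck_on k (\<phi> ` (N \<inter> V)) (f \<circ> inv_into V \<phi>)"
    using smooth_at_obtain[OF assms(1)] by blast
  have "Ck_on k (\<phi> ` ((N \<inter> W) \<inter> V)) (h \<circ> inv_into V \<phi>)" if V: "(V, \<phi>) \<in> A" for V \<phi> k
  proof -
    have "Ck_on k (\<phi> ` ((N \<inter> W) \<inter> V)) (f \<circ> inv_into V \<phi>)"
      by (rule Ck_on_subset[OF N(3)[OF V]]) auto
    moreover have "(f \<circ> inv_into V \<phi>) x = (h \<circ> inv_into V \<phi>) x" if "x \<in> \<phi> ` ((N \<inter> W) \<inter> V)" for x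
      using that assms(4) chart_open_image(2)[OF V N(1)] by auto
    ultimately show ?thesis
      using Ck_on_cong[OF chart_open_image(1)[OF V open_Int[OF N(1) assms(2)]]] by blast
  qed
  then show ?thesis
    using N(1,2) assms(2,3) by (intro smooth_atI[of "N \<inter> W"]) auto
qed

lemma smooth_at_const: "smooth_at A p (\<lambda>q. a)"
  unfolding smooth_at_def Cinf_on_def by (rule exI[of _ UNIV]) (auto simp: o_def Ck_on_const)

lemma
  assumes "smooth_at A p f" "smooth_at A p h"
  shows smooth_at_add: "smooth_at A p (\<lambda>q. f q + h q)"
    and smooth_at_mult: "smooth_at A p (\<lambda>q. f q * h q)"
proof -
  obtain N where N: "open N" "p \<in> N" "\<And>V \<phi> k. (V, \<phi>) \<in> A \<Longrightarrow> Ck_on k (\<phi> ` (N \<inter> V)) (f \<circ> inv_into V \<phi>)"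
    using smooth_at_obtain[OF assms(1)] by blast
  obtain N' where N': "open N'" "p \<in> N'" "\<And>V \<phi> k. (V, \<phi>) \<in> A \<Longrightarrow> Ck_on k (\<phi> ` (N' \<inter> V)) (h \<circ> inv_into V \<phi>)"
    using smooth_at_obtain[OF assms(2)] by blast
  have *: "Ck_on k (\<phi> ` ((N \<inter> N') \<inter> V)) ((\<lambda>q. f q + h q) \<circ> inv_into V \<phi>)"
      "Ck_on k (\<phi> ` ((N \<inter> N') \<inter> V)) ((\<lambda>q. f q * h q) \<circ> inv_into V \<phi>)" if V: "(V, \<phi>) \<in> A" for V \<phi> k
  proof -
    have "Ck_on k (\<phi> ` ((N \<inter> N') \<inter> V)) (\<lambda>x. f (inv_into V \<phi> x))"
      by (rule Ck_on_subset[OF N(3)[OF V, unfolded o_def]]) auto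
    moreover have "Ck_on k (\<phi> ` ((N \<inter> N') \<inter> V)) (\<lambda>x. h (inv_into V \<phi> x))"
      by (rule Ck_on_subset[OF N'(3)[OF V, unfolded o_def]]) auto
    moreover have "open (\<phi> ` ((N \<inter> N') \<inter> V))"
      using chart_open_image(1)[OF V] N(1) N'(1) by blast
    ultimately show "Ck_on k (\<phi> ` ((N \<inter> N') \<inter> V)) ((\<lambda>q. f q + h q) \<circ> inv_into V \<phi>)"
      "Ck_on k (\<phi> ` ((N \<inter> N') \<inter> V)) ((\<lambda>q. f q * h q) \<circ> inv_into V \<phi>)"
      by (simp_all add: o_def Ck_on_add Ck_on_mult)
  qed
  show "smooth_at A p (\<lambda>q. f q + h q)" "smooth_at A p (\<lambda>q. f q * h q)"
    using N(1,2) N'(1,2) by (auto intro!: smooth_atI[of "N \<inter> N'"] *)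
qed

lemma tangent_spaceD:
  assumes "v \<in> tangent_space A p"
  shows "\<not> smooth_at A p f \<Longrightarrow> v f = 0"
    and "smooth_at A p f \<Longrightarrow> smooth_at A p h \<Longrightarrow> v (\<lambda>x. f x + h x) = v f + v h"
    and "smooth_at A p f \<Longrightarrow> v (\<lambda>x. a * f x) = a * v f"
    and "smooth_at A p f \<Longrightarrow> smooth_at A p h \<Longrightarrow> v (\<lambda>x. f x * h x) = f p * v h + h p * v f"
  using assms by (simp_all add: tangent_space_def)

lemma tangent_const:
  assumes "v \<in> tangent_space A p"
  shows "v (\<lambda>q. a) = 0"
proof -
  have "v (\<lambda>q. 1 * 1) = 1 * v (\<lambda>q. 1) + 1 * v (\<lambda>q. 1)"
    by (rule tangent_spaceD(4)[OF assms smooth_at_const smooth_at_const])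
  then show ?thesis
    using tangent_spaceD(3)[OF assms smooth_at_const, of a 1] by simp
qed

text \<open>A derivation is local: the indicator function of \<open>W\<close> is smooth at \<open>p\<close>, idempotent, and hence
  has derivative zero, so that multiplication with it does not change \<open>v f\<close>.\<close>

lemma tangent_local:
  assumes v: "v \<in> tangent_space A p" and f: "smooth_at A p f"
    and W: "open W" "p \<in> W" "\<And>q. q \<in> W \<Longrightarrow> f q = h q"
  shows "v f = v h"
proof -
  define \<kappa> :: "'m \<Rightarrow> real" where "\<kappa> = (\<lambda>q. if q \<in> W then 1 else 0)"
  have \<kappa>: "smooth_at A p \<kappa>" "\<kappa> p = 1"
    using smooth_at_cong[OF smooth_at_const[of p 1] W(1,2)] W(2) by (simp_all add: \<kappa>_def)
  have "(\<lambda>q. \<kappa> q * \<kappa> q) = \<kappa>"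
    by (auto simp: \<kappa>_def)
  then have "v \<kappa> = 0"
    using tangent_spaceD(4)[OF v \<kappa>(1) \<kappa>(1)] \<kappa>(2) by simp
  then have cut: "v (\<lambda>q. u q * \<kappa> q) = v u" if "smooth_at A p u" for u
    using tangent_spaceD(4)[OF v that \<kappa>(1)] \<kappa>(2) by simp
  have "(\<lambda>q. f q * \<kappa> q) = (\<lambda>q. h q * \<kappa> q)"
    using W(3) by (auto simp: \<kappa>_def)
  then show ?thesis
    using cut[OF f] cut[OF smooth_at_cong[OF f W]] by simp
qed

lemma tangent_lincomb:
  assumes "u \<in> tangent_space A p" "v \<in> tangent_space A p"
  shows "(\<lambda>f. a * u f + b * v f) \<in> tangent_space A p"
  using assms by (simp add: tangent_space_def algebra_simps)

lemma tangent_zero: "(\<lambda>f. 0) \<in> tangent_space A p"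
  by (simp add: tangent_space_def)

lemma tangent_sum:
  assumes "\<And>i. i \<in> I \<Longrightarrow> v i \<in> tangent_space A p"
  shows "(\<lambda>f. \<Sum>i\<in>I. a i * v i f) \<in> tangent_space A p"
  using assms
proof (induction I rule: infinite_finite_induct)
  case (insert i I)
  then show ?case
    using tangent_lincomb[of "v i" p "\<lambda>f. \<Sum>i\<in>I. a i * v i f" "a i" 1] by simp
qed (simp_all add: tangent_zero)

text \<open>The form in which multilinearity of the metric and of the torsion form is applied to frame
  expansions.\<close>

lemma linear_on_tangent_sum:
  fixes F :: "'m tvec \<Rightarrow> real"
  assumes lin: "\<And>u v a b. u \<in> tangent_space A p \<Longrightarrow> v \<in> tangent_space A p \<Longrightarrow>
      F (\<lambda>f. a * u f + b * v f) = a * F u + b * F v"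
    and v: "\<And>i. i \<in> I \<Longrightarrow> v i \<in> tangent_space A p"
  shows "F (\<lambda>f. \<Sum>i\<in>I. a i * v i f) = (\<Sum>i\<in>I. a i * F (v i))"
proof -
  have zero: "F (\<lambda>f. 0) = 0"
    using lin[OF tangent_zero tangent_zero, of 0 0] by simp
  show ?thesis
    using v
  proof (induction I rule: infinite_finite_induct)
    case (insert i I)
    then show ?case
      using lin[of "v i" "\<lambda>f. \<Sum>i\<in>I. a i * v i f" "a i" 1] tangent_sum[of I v p a] by simp
  qed (simp_all add: zero)
qed

end

lemma vec_deriv_basis:
  fixes \<psi> :: "'m \<Rightarrow> complex ^ 's::finite"
  shows "vec_deriv v \<psi> = (\<Sum>b\<in>Basis. v (\<lambda>q. \<psi> q \<bullet> b) *\<^sub>R b)"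
proof (rule euclidean_eqI)
  fix b :: "complex ^ 's" assume b: "b \<in> Basis"
  then obtain s u where "b = axis s u" "u \<in> {1, \<i>}"
    by (auto simp: Basis_vec_def Basis_complex_def)
  then have "vec_deriv v \<psi> \<bullet> b = v (\<lambda>q. \<psi> q \<bullet> b)"
    by (auto simp: vec_deriv_def inner_axis inner_complex_def)
  then show "vec_deriv v \<psi> \<bullet> b = (\<Sum>b\<in>Basis. v (\<lambda>q. \<psi> q \<bullet> b) *\<^sub>R b) \<bullet> b"
    by (simp add: inner_sum_left_Basis b)
qed

section \<open>Orthonormal frames and the torsion connection\<close>

locale local_frame =
  fixes A :: "('m::topological_space, 'n::finite) atlas"
    and g :: "'m bilin"
    and U :: "'m set"
    and e :: "'n \<Rightarrow> 'm vfield"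
  assumes atlas: "smooth_atlas A"
    and metric: "riemannian_metric A g"
    and open_U: "open U"
    and onb: "orthonormal_frame A g U e"
begin

lemma frame_field: "vector_field_on A U (e i)"
  using onb by (simp add: orthonormal_frame_def)

lemma frame_field_at: "q \<in> U \<Longrightarrow> vector_field_at A q (e i)"
  unfolding vector_field_at_def using open_U frame_field by blast

lemma frame_tangent: "q \<in> U \<Longrightarrow> e i q \<in> tangent_space A q"
  using frame_field by (simp add: vector_field_on_def)

sublocale derivation_frame U "\<lambda>f. \<forall>q\<in>U. smooth_at A q f" "\<lambda>i f q. e i q f"
proof
  fix f h :: "'m \<Rightarrow> real" and a i p
  show "\<forall>q\<in>U. smooth_at A q (\<lambda>q. a)"
    by (simp add: smooth_at_const atlas)
  show "\<forall>q\<in>U. smooth_at A q f \<Longrightarrow> \<forall>q\<in>U. smooth_at A q h \<Longrightarrow> \<forall>q\<in>U. smooth_at A q (\<lambda>q. f q + h q)"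
    by (simp add: smooth_at_add atlas)
  show "\<forall>q\<in>U. smooth_at A q f \<Longrightarrow> \<forall>q\<in>U. smooth_at A q h \<Longrightarrow> \<forall>q\<in>U. smooth_at A q (\<lambda>q. f q * h q)"
    by (simp add: smooth_at_mult atlas)
  show "\<forall>q\<in>U. smooth_at A q f \<Longrightarrow> \<forall>q\<in>U. smooth_at A q (\<lambda>q. e i q f)"
    using frame_field by (simp add: vector_field_on_def)
  assume p: "p \<in> U"
  show "e i p (\<lambda>q. a) = 0"
    by (rule tangent_const[OF atlas frame_tangent[OF p]])
  show "\<forall>q\<in>U. smooth_at A q f \<Longrightarrow> \<forall>q\<in>U. smooth_at A q h \<Longrightarrow> e i p (\<lambda>q. f q + h q) = e i p f + e i p h"
    using p tangent_spaceD(2)[OF atlas frame_tangent[OF p]] by simp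
  show "\<forall>q\<in>U. smooth_at A q f \<Longrightarrow> \<forall>q\<in>U. smooth_at A q h \<Longrightarrow>
      e i p (\<lambda>q. f q * h q) = f p * e i p h + h p * e i p f"
    using p tangent_spaceD(4)[OF atlas frame_tangent[OF p]] by simp
  show "\<forall>q\<in>U. smooth_at A q f \<Longrightarrow> (\<And>q. q \<in> U \<Longrightarrow> f q = h q) \<Longrightarrow> e i p f = e i p h"
    using p tangent_local[OF atlas frame_tangent[OF p] _ open_U p] by simp
qed

lemma metric_linear:
  assumes "u \<in> tangent_space A q" "v \<in> tangent_space A q" "w \<in> tangent_space A q"
  shows "g q (\<lambda>f. a * u f + b * v f) w = a * g q u w + b * g q v w"
    and "g q w (\<lambda>f. a * u f + b * v f) = a * g q w u + b * g q w v"
proof -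
  show *: "g q (\<lambda>f. a * u f + b * v f) w = a * g q u w + b * g q v w"
    using metric assms by (simp add: riemannian_metric_def)
  have "g q w x = g q x w" if "x \<in> tangent_space A q" for x
    using metric assms(3) that by (simp add: riemannian_metric_def)
  with * show "g q w (\<lambda>f. a * u f + b * v f) = a * g q w u + b * g q w v"
    using assms tangent_lincomb[OF atlas assms(1,2)] by simp
qed

lemma metric_smooth: "vector_field_at A q X \<Longrightarrow> vector_field_at A q Y \<Longrightarrow> smooth_at A q (\<lambda>x. g x (X x) (Y x))"
  using metric by (simp add: riemannian_metric_def)

lemma metric_frame: "q \<in> U \<Longrightarrow> g q (e i q) (e j q) = (if i = j then 1 else 0)"
  using onb by (simp add: orthonormal_frame_def)

lemma metric_coefficient:
  assumes q: "q \<in> U"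
  shows "g q (\<lambda>f. \<Sum>i\<in>UNIV. a i * e i q f) (e j q) = a j"
  using linear_on_tangent_sum[OF atlas, where F="\<lambda>u. g q u (e j q)" and p=q and v="\<lambda>i. e i q" and I=UNIV and a=a]
  by (simp add: metric_linear frame_tangent q metric_frame if_distrib[of "\<lambda>x. _ * x"] cong: if_cong)

lemma frame_expansion:
  assumes q: "q \<in> U" and v: "v \<in> tangent_space A q"
  shows "v = (\<lambda>f. \<Sum>i\<in>UNIV. g q v (e i q) * e i q f)"
proof -
  obtain a where a: "v = (\<lambda>f. \<Sum>i\<in>UNIV. a i * e i q f)"
    using onb q v unfolding orthonormal_frame_def by blast
  then show ?thesis
    by (simp add: metric_coefficient[OF q])
qed

lemma sharp_frame:
  assumes q: "q \<in> U"
    and lin: "\<And>u v a b. u \<in> tangent_space A q \<Longrightarrow> v \<in> tangent_space A q \<Longrightarrow>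
      \<alpha> (\<lambda>f. a * u f + b * v f) = a * \<alpha> u + b * \<alpha> v"
  shows "sharp A g q \<alpha> = (\<lambda>f. \<Sum>m\<in>UNIV. \<alpha> (e m q) * e m q f)" (is "_ = ?v")
  unfolding sharp_def
proof (rule the_equality, intro conjI ballI)
  show v: "?v \<in> tangent_space A q"
    by (rule tangent_sum[OF atlas frame_tangent[OF q]])
  fix w assume w: "w \<in> tangent_space A q"
  have "g q ?v w = g q ?v (\<lambda>f. \<Sum>i\<in>UNIV. g q w (e i q) * e i q f)"
    by (subst frame_expansion[OF q w]) (rule refl)
  also have "\<dots> = (\<Sum>i\<in>UNIV. g q w (e i q) * g q ?v (e i q))"
    by (rule linear_on_tangent_sum[OF atlas metric_linear(2)[OF _ _ v] frame_tangent[OF q]])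
  also have "\<dots> = (\<Sum>i\<in>UNIV. g q w (e i q) * \<alpha> (e i q))"
    by (simp only: metric_coefficient[OF q])
  also have "\<dots> = \<alpha> (\<lambda>f. \<Sum>i\<in>UNIV. g q w (e i q) * e i q f)"
    by (rule linear_on_tangent_sum[OF atlas lin frame_tangent[OF q], symmetric])
  finally show "g q ?v w = \<alpha> w"
    by (simp only: frame_expansion[OF q w, symmetric])
next
  fix v assume "v \<in> tangent_space A q \<and> (\<forall>w\<in>tangent_space A q. g q v w = \<alpha> w)"
  then have v: "v \<in> tangent_space A q" and \<alpha>: "g q v (e i q) = \<alpha> (e i q)" for i
    using frame_tangent[OF q] by auto
  show "v = ?v"
    using frame_expansion[OF q v] unfolding \<alpha> .
qed

lemma local_frame_restrict: "open W \<Longrightarrow> local_frame A g (U \<inter> W) e"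
  using atlas metric open_U onb
  by (auto simp: local_frame_def orthonormal_frame_def vector_field_on_def)

end

text \<open>A Riemannian manifold with parallel skew torsion, seen in an orthonormal frame on an open set.\<close>

locale torsion_frame = local_frame A g U e
  for A :: "('m::topological_space, 'n::finite) atlas" and g :: "'m bilin" and U :: "'m set"
    and e :: "'n \<Rightarrow> 'm vfield" +
  fixes LC :: "'m connection" and T :: "'m trilin"
  assumes levi_civita: "levi_civita A g LC"
    and three_form: "three_form A T"
    and parallel: "parallel_form A (torsion_connection A g LC T) T"
begin

definition tc :: "'n \<Rightarrow> 'n \<Rightarrow> 'n \<Rightarrow> 'm \<Rightarrow> real" where
  "tc i j k q = T q (e i q) (e j q) (e k q)"

definition \<Gamma> :: "'n \<Rightarrow> 'n \<Rightarrow> 'n \<Rightarrow> 'm \<Rightarrow> real" where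
  "\<Gamma> l i j q = g q (LC (e l) (e i) q) (e j q)"

definition \<omega> :: "'n \<Rightarrow> 'n \<Rightarrow> 'n \<Rightarrow> 'm \<Rightarrow> real" where
  "\<omega> l i j q = \<Gamma> l i j q + 1 / 2 * tc l i j q"

text \<open>The structure functions of the frame; the Levi-Civita connection has no torsion, so they are
  \<open>g(\<nabla>\<^sup>g\<^sub>k e\<^sub>l - \<nabla>\<^sup>g\<^sub>l e\<^sub>k, e\<^sub>m)\<close>.\<close>

definition cs :: "'n \<Rightarrow> 'n \<Rightarrow> 'n \<Rightarrow> 'm \<Rightarrow> real" where
  "cs k l m q = \<Gamma> k l m q - \<Gamma> l k m q"

lemma LC_field_at:
  assumes q: "q \<in> U"
  shows "vector_field_at A q (LC (e l) (e i))"
proof -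
  have "affine_connection A LC"
    using levi_civita by (simp add: levi_civita_def)
  from this[unfolded affine_connection_def, rule_format, OF
      frame_field_at[OF q] frame_field_at[OF q] frame_field_at[OF q] smooth_at_const[OF atlas]]
  show ?thesis
    by (rule conjunct1)
qed

lemma LC_tangent: "q \<in> U \<Longrightarrow> LC (e l) (e i) q \<in> tangent_space A q"
  using LC_field_at[of q l i] by (auto simp: vector_field_at_def vector_field_on_def)

lemma LC_frame: "q \<in> U \<Longrightarrow> LC (e l) (e i) q = (\<lambda>f. \<Sum>m\<in>UNIV. \<Gamma> l i m q * e m q f)"
  unfolding \<Gamma>_def by (rule frame_expansion[OF _ LC_tangent])

lemma smooth_\<Gamma>: "\<forall>q\<in>U. smooth_at A q (\<Gamma> l i j)"
  unfolding \<Gamma>_def[abs_def] using metric_smooth LC_field_at frame_field_at by blast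

lemma smooth_tc: "\<forall>q\<in>U. smooth_at A q (tc i j k)"
  unfolding tc_def[abs_def] using three_form frame_field_at unfolding three_form_def by blast

lemma smooth_\<omega>: "\<forall>q\<in>U. smooth_at A q (\<omega> l i j)"
  unfolding \<omega>_def[abs_def] by (rule smooth_add[OF smooth_\<Gamma> smooth_cmult[OF smooth_tc]])

lemma smooth_cs: "\<forall>q\<in>U. smooth_at A q (cs k l m)"
  unfolding cs_def[abs_def] by (rule smooth_diff[OF smooth_\<Gamma> smooth_\<Gamma>])

lemma T_alt:
  assumes "u \<in> tangent_space A q" "v \<in> tangent_space A q" "w \<in> tangent_space A q"
  shows "T q v u w = - T q u v w" "T q u w v = - T q u v w"
  using three_form[unfolded three_form_def, THEN conjunct2, THEN conjunct1, rule_format, OF assms]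
  by (rule conjunct1, rule conjunct2)

lemma T_linear1:
  assumes "u \<in> tangent_space A q" "v \<in> tangent_space A q" "w \<in> tangent_space A q" "z \<in> tangent_space A q"
  shows "T q (\<lambda>f. a * u f + b * v f) w z = a * T q u w z + b * T q v w z"
  by (rule three_form[unfolded three_form_def, THEN conjunct1, rule_format, OF assms])

lemma T_linear3:
  assumes "u \<in> tangent_space A q" "v \<in> tangent_space A q" "w \<in> tangent_space A q" "z \<in> tangent_space A q"
  shows "T q w z (\<lambda>f. a * u f + b * v f) = a * T q w z u + b * T q w z v"
proof -
  have "T q w z x = T q x w z" if "x \<in> tangent_space A q" for x
    using T_alt assms that by (metis minus_minus)
  then show ?thesis
    using T_linear1 assms tangent_lincomb[OF atlas assms(1,2)] by simp
qed

lemma tc_alt: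
  assumes "q \<in> U"
  shows "tc j i k q = - tc i j k q" "tc i k j q = - tc i j k q"
  unfolding tc_def by (intro T_alt frame_tangent assms)+

lemma T_sum1:
  assumes "q \<in> U" "w \<in> tangent_space A q" "z \<in> tangent_space A q"
  shows "T q (\<lambda>f. \<Sum>m\<in>UNIV. a m * e m q f) w z = (\<Sum>m\<in>UNIV. a m * T q (e m q) w z)"
  by (rule linear_on_tangent_sum[OF atlas T_linear1[OF _ _ assms(2,3)] frame_tangent[OF assms(1)]])

lemma T_sum2:
  assumes q: "q \<in> U" and "w \<in> tangent_space A q" "z \<in> tangent_space A q"
  shows "T q w (\<lambda>f. \<Sum>m\<in>UNIV. a m * e m q f) z = (\<Sum>m\<in>UNIV. a m * T q w (e m q) z)"
proof -
  have "T q w (\<lambda>f. \<Sum>m\<in>UNIV. a m * e m q f) z = - T q (\<lambda>f. \<Sum>m\<in>UNIV. a m * e m q f) w z"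
    by (rule T_alt(1)[OF tangent_sum[OF atlas frame_tangent[OF q]] assms(2,3)])
  also have "\<dots> = (\<Sum>m\<in>UNIV. a m * - T q (e m q) w z)"
    by (simp add: T_sum1[OF assms] sum_negf)
  also have "\<dots> = (\<Sum>m\<in>UNIV. a m * T q w (e m q) z)"
    by (simp only: T_alt(1)[OF frame_tangent[OF q] assms(2,3)])
  finally show ?thesis .
qed

lemma T_sum3:
  assumes "q \<in> U" "w \<in> tangent_space A q" "z \<in> tangent_space A q"
  shows "T q w z (\<lambda>f. \<Sum>m\<in>UNIV. a m * e m q f) = (\<Sum>m\<in>UNIV. a m * T q w z (e m q))"
  by (rule linear_on_tangent_sum[OF atlas T_linear3[OF _ _ assms(2,3)] frame_tangent[OF assms(1)]])

lemma torsion_connection_frame: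
  assumes q: "q \<in> U"
  shows "torsion_connection A g LC T (e l) (e i) q = (\<lambda>f. \<Sum>m\<in>UNIV. \<omega> l i m q * e m q f)"
proof -
  have "sharp A g q (T q (e l q) (e i q)) = (\<lambda>f. \<Sum>m\<in>UNIV. tc l i m q * e m q f)"
    unfolding tc_def by (intro sharp_frame[OF q] T_linear3 frame_tangent[OF q])
  then show ?thesis
    by (simp add: torsion_connection_def LC_frame[OF q] \<omega>_def sum.distrib sum_distrib_left
        distrib_right sum_divide_distrib)
qed

lemma \<Gamma>_skew:
  assumes q: "q \<in> U"
  shows "\<Gamma> l j i q = - \<Gamma> l i j q"
proof -
  have sym: "g q (e i q) (LC (e l) (e j) q) = \<Gamma> l j i q"
    unfolding \<Gamma>_def using metric frame_tangent[OF q] LC_tangent[OF q] by (simp add: riemannian_metric_def)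
  have "e l q (\<lambda>x. g x (e i x) (e j x)) = \<Gamma> l i j q + \<Gamma> l j i q"
    using levi_civita[unfolded levi_civita_def, THEN conjunct2, THEN conjunct1, rule_format, OF
        frame_field_at[OF q] frame_field_at[OF q] frame_field_at[OF q]]
    by (simp add: sym) (simp add: \<Gamma>_def)
  moreover have "e l q (\<lambda>x. g x (e i x) (e j x)) = e l q (\<lambda>x. if i = j then 1 else 0)"
    using metric_smooth frame_field_at by (intro d_cong[OF _ _ q]) (auto simp: metric_frame)
  ultimately show ?thesis
    by (simp add: d_const[OF q])
qed

lemma lie_bracket_frame:
  assumes q: "q \<in> U"
  shows "lie_bracket A (e k) (e l) q = (\<lambda>f. \<Sum>m\<in>UNIV. cs k l m q * e m q f)"
proof -
  have "lie_bracket A (e k) (e l) q = (\<lambda>f. LC (e k) (e l) q f - LC (e l) (e k) q f)"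
    using levi_civita[unfolded levi_civita_def, THEN conjunct2, THEN conjunct2, rule_format, OF
        frame_field_at[OF q] frame_field_at[OF q]] by (rule sym)
  then show ?thesis
    by (simp add: LC_frame[OF q] cs_def left_diff_distrib sum_subtractf)
qed

lemma frame_commutator:
  assumes f: "\<forall>q\<in>U. smooth_at A q f" and q: "q \<in> U"
  shows "e k q (\<lambda>q. e l q f) - e l q (\<lambda>q. e k q f) = (\<Sum>m\<in>UNIV. cs k l m q * e m q f)"
  using fun_cong[OF lie_bracket_frame[OF q, of k l], of f] f q by (simp add: lie_bracket_def)

text \<open>The coefficients of a vector are determined by its values on functions that are smooth near \<open>q\<close>.
  Such a function need not be smooth on all of \<open>U\<close>, so the Jacobi identity is applied on a smaller
  open set for each function.\<close>

lemma frame_jacobi: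
  assumes q: "q \<in> U"
  shows "e k q (cs l i m) + e l q (cs i k m) + e i q (cs k l m) =
    - (\<Sum>n\<in>UNIV. cs l i n q * cs k n m q + cs i k n q * cs l n m q + cs k l n q * cs i n m q)"
proof -
  define J where "J m = e k q (cs l i m) + e l q (cs i k m) + e i q (cs k l m)
    + (\<Sum>n\<in>UNIV. cs l i n q * cs k n m q + cs i k n q * cs l n m q + cs k l n q * cs i n m q)" for m
  have "(\<Sum>m\<in>UNIV. J m * e m q f) = 0" for f
  proof (cases "smooth_at A q f")
    case True
    then obtain N where N: "open N" "q \<in> N" "\<forall>x\<in>N. smooth_at A x f"
      using smooth_at_nbhd[OF atlas] by blast
    interpret W: local_frame A g "U \<inter> N" e
      by (rule local_frame_restrict[OF N(1)])
    interpret W: torsion_frame A g "U \<inter> N" e LC T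
      by unfold_locales (rule levi_civita three_form parallel)+
    show ?thesis
      unfolding J_def
      by (rule W.structure_functions_jacobi[OF W.smooth_cs W.frame_commutator]) (use N q in auto)
  next
    case False
    then show ?thesis
      by (simp add: tangent_spaceD(1)[OF atlas frame_tangent[OF q]])
  qed
  then have "(\<lambda>f. \<Sum>m\<in>UNIV. J m * e m q f) = (\<lambda>f. \<Sum>m\<in>UNIV. 0 * e m q f)"
    by simp
  then have "J m = 0"
    using metric_coefficient[OF q, of J m] metric_coefficient[OF q, of "\<lambda>_. 0" m] by simp
  then show ?thesis
    by (simp add: J_def)
qed

lemma tc_parallel:
  assumes q: "q \<in> U"
  shows "e l q (tc i j k) =
    (\<Sum>m\<in>UNIV. \<omega> l i m q * tc m j k q + \<omega> l j m q * tc i m k q + \<omega> l k m q * tc i j m q)"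
proof -
  have "cov_deriv (torsion_connection A g LC T) T (e l) (e i) (e j) (e k) q = 0"
    using parallel frame_field_at[OF q] by (simp add: parallel_form_def)
  then show ?thesis
    by (simp add: cov_deriv_def torsion_connection_frame[OF q] T_sum1 T_sum2 T_sum3 q frame_tangent
        tc_def[symmetric] tc_def[abs_def, symmetric] sum.distrib)
qed

text \<open>Since \<open>\<nabla>T = 0\<close>, the Levi-Civita derivative of \<open>T\<close> is the derivation action of \<open>\<nabla> - \<nabla>\<^sup>g = \<onehalf> T\<close>
  on \<open>T\<close>. With the direction repeated in the first slot, the three slots contribute
  \<open>\<onehalf> \<Sum>\<^sub>m t\<^bsub>kkm\<^esub> t\<^bsub>mij\<^esub> + t\<^bsub>kim\<^esub> t\<^bsub>kmj\<^esub> + t\<^bsub>kjm\<^esub> t\<^bsub>kim\<^esub>\<close>, where the first term is zero and the other two cancel.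
  Thus every summand of the codifferential vanishes separately.\<close>

lemma codifferential_zero:
  assumes q: "q \<in> U"
  shows "cov_deriv LC T (e k) (e k) (e i) (e j) q = 0"
proof -
  have "cov_deriv LC T (e k) (e k) (e i) (e j) q =
      (\<Sum>m\<in>UNIV. (\<omega> k k m q - \<Gamma> k k m q) * tc m i j q + (\<omega> k i m q - \<Gamma> k i m q) * tc k m j q
        + (\<omega> k j m q - \<Gamma> k j m q) * tc k i m q)"
    by (simp add: cov_deriv_def LC_frame[OF q] T_sum1 T_sum2 T_sum3 q frame_tangent
        tc_def[symmetric] tc_def[abs_def, symmetric] tc_parallel[OF q] sum.distrib left_diff_distrib sum_subtractf)
  also have "\<dots> = 0"
  proof (rule sum.neutral, rule ballI)
    fix m
    have "tc k k m q = 0" "tc k m j q = - tc k j m q"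
      using tc_alt[OF q, of k k m] tc_alt[OF q, of k j m] by simp_all
    then show "(\<omega> k k m q - \<Gamma> k k m q) * tc m i j q + (\<omega> k i m q - \<Gamma> k i m q) * tc k m j q
        + (\<omega> k j m q - \<Gamma> k j m q) * tc k i m q = 0"
      by (simp add: \<omega>_def)
  qed
  finally show ?thesis .
qed

text \<open>In the formula for \<open>dT\<close> the derivatives are given by parallelism and the brackets by
  \<open>\<nabla>\<^sub>X Y - \<nabla>\<^sub>Y X - T(X, Y)\<close>. The connection coefficients cancel, and the products
  \<open>T(T(X, Y), Z, W)\<close> that remain are the shuffles in \<open>2 \<sigma>\<^sub>T\<close>.\<close>

lemma ext_deriv_eq_sigma:
  assumes q: "q \<in> U"
  shows "ext_deriv A T (e i) (e j) (e k) (e l) q =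
    2 * (1 / 2 * (\<Sum>m\<in>UNIV. wedge2 (T q (e m q)) (T q (e m q)) (e i q) (e j q) (e k q) (e l q)))"
proof -
  have "ext_deriv A T (e i) (e j) (e k) (e l) q = (\<Sum>m\<in>UNIV.
      (\<omega> i j m q * tc m k l q + \<omega> i k m q * tc j m l q + \<omega> i l m q * tc j k m q)
    - (\<omega> j i m q * tc m k l q + \<omega> j k m q * tc i m l q + \<omega> j l m q * tc i k m q)
    + (\<omega> k i m q * tc m j l q + \<omega> k j m q * tc i m l q + \<omega> k l m q * tc i j m q)
    - (\<omega> l i m q * tc m j k q + \<omega> l j m q * tc i m k q + \<omega> l k m q * tc i j m q)
    - cs i j m q * tc m k l q + cs i k m q * tc m j l q - cs i l m q * tc m j k q
    - cs j k m q * tc m i l q + cs j l m q * tc m i k q - cs k l m q * tc m i j q)"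
    by (simp add: ext_deriv_def lie_bracket_frame[OF q] T_sum1 q frame_tangent
        tc_def[symmetric] tc_def[abs_def, symmetric] tc_parallel[OF q] sum.distrib sum_subtractf)
  also have "\<dots> = (\<Sum>m\<in>UNIV. wedge2 (T q (e m q)) (T q (e m q)) (e i q) (e j q) (e k q) (e l q))"
  proof (rule sum.cong[OF refl])
    fix m
    have m: "tc a m b q = - tc m a b q" "tc a b m q = tc m a b q" for a b
      using tc_alt[OF q] by (metis minus_minus)+
    have s: "tc m j i q = - tc m i j q" "tc m k i q = - tc m i k q" "tc m l i q = - tc m i l q"
      "tc m k j q = - tc m j k q" "tc m l j q = - tc m j l q" "tc m l k q = - tc m k l q"
      by (rule tc_alt(2)[OF q])+
    show "(\<omega> i j m q * tc m k l q + \<omega> i k m q * tc j m l q + \<omega> i l m q * tc j k m q)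
    - (\<omega> j i m q * tc m k l q + \<omega> j k m q * tc i m l q + \<omega> j l m q * tc i k m q)
    + (\<omega> k i m q * tc m j l q + \<omega> k j m q * tc i m l q + \<omega> k l m q * tc i j m q)
    - (\<omega> l i m q * tc m j k q + \<omega> l j m q * tc i m k q + \<omega> l k m q * tc i j m q)
    - cs i j m q * tc m k l q + cs i k m q * tc m j l q - cs i l m q * tc m j k q
    - cs j k m q * tc m i l q + cs j l m q * tc m i k q - cs k l m q * tc m i j q =
      wedge2 (T q (e m q)) (T q (e m q)) (e i q) (e j q) (e k q) (e l q)"
      unfolding wedge2_def tc_def[symmetric] \<omega>_def cs_def
      by (simp only: m s) (simp add: algebra_simps)
  qed
  finally show ?thesis
    by simp
qed

lemma spin_calculus_frame:
  fixes \<gamma> :: "'n \<Rightarrow> complex ^ 's ^ 's::finite"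
  assumes "clifford_matrices \<gamma>"
  shows "spin_calculus U (\<lambda>f. \<forall>q\<in>U. smooth_at A q f) (\<lambda>i f q. e i q f) (\<lambda>i x. \<gamma> i *v x) \<omega> tc cs"
proof -
  interpret clifford_action "\<lambda>i x. \<gamma> i *v x"
    by (rule clifford_matrices_action[OF assms])
  show ?thesis
  proof
    fix l i j k m q
    show "\<forall>q\<in>U. smooth_at A q (\<omega> l i j)" "\<forall>q\<in>U. smooth_at A q (tc i j k)"
      by (rule smooth_\<omega> smooth_tc)+
    assume q: "q \<in> U"
    show "tc j i k q = - tc i j k q" "tc i k j q = - tc i j k q"
      by (rule tc_alt[OF q])+
    show "\<omega> l j i q = - \<omega> l i j q"
      by (simp add: \<omega>_def \<Gamma>_skew[OF q, of l j i] tc_alt(2)[OF q, of l j i])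
    show "cs k l m q = \<omega> k l m q - \<omega> l k m q - tc k l m q"
      by (simp add: cs_def \<omega>_def tc_alt(1)[OF q, of l k m])
    show "e l q (tc i j k) =
      (\<Sum>m\<in>UNIV. \<omega> l i m q * tc m j k q + \<omega> l j m q * tc i m k q + \<omega> l k m q * tc i j m q)"
      by (rule tc_parallel[OF q])
    show "e k q (cs l i m) + e l q (cs i k m) + e i q (cs k l m) =
      - (\<Sum>n\<in>UNIV. cs l i n q * cs k n m q + cs i k n q * cs l n m q + cs k l n q * cs i n m q)"
      by (rule frame_jacobi[OF q])
    show "e k q (\<lambda>q. e l q f) - e l q (\<lambda>q. e k q f) = (\<Sum>m\<in>UNIV. cs k l m q * e m q f)"
      if "\<forall>q\<in>U. smooth_at A q f" for f
      by (rule frame_commutator[OF that q])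
  qed
qed

end

section \<open>The Casimir operator commutes with the torsion form\<close>

theorem proposition3p4:
  fixes M :: "('m::{t2_space, second_countable_topology}, 'n::{finite, linorder}, 's::finite, 'i) spin_mfd"
    and LC :: "'m connection"
    and T :: "'m trilin"
  assumes "riemannian_spin_manifold M"
    and "levi_civita (charts M) (met M) LC"
    and "three_form (charts M) T"
    and "parallel_form (charts M) (torsion_connection (charts M) (met M) LC T) T"
  shows
    "commute_on_spinors M (casimir M LC T) (torsion_endo M T) \<and>
     commute_on_spinors M (dirac_third_sq M LC T) (torsion_endo M T)"
proof -
  have "casimir M LC T (torsion_endo M T \<psi>) a p = torsion_endo M T (casimir M LC T \<psi>) a p \<and>
      dirac_third_sq M LC T (torsion_endo M T \<psi>) a p = torsion_endo M T (dirac_third_sq M LC T \<psi>) a p"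
    if \<psi>: "spinor_field M \<psi>" and p: "p \<in> cover M a" for \<psi> a p
  proof -
    have \<gamma>: "clifford_matrices (gam M)"
      using assms(1) by (simp add: riemannian_spin_manifold_def spin_structure_def)
    interpret F: torsion_frame "charts M" "met M" "cover M a" "frame M a" LC T
      using assms by unfold_locales (auto simp: riemannian_spin_manifold_def spin_structure_def)
    interpret S: spin_calculus "cover M a" "\<lambda>f. \<forall>q\<in>cover M a. smooth_at (charts M) q f"
      "\<lambda>i f q. frame M a i q f" "\<lambda>i x. gam M i *v x" F.\<omega> F.tc F.cs
      by (rule F.spin_calculus_frame[OF \<gamma>])
    have tor: "torsion_endo M T \<phi> a q = S.tor q (\<phi> a q)" if "q \<in> cover M a" for \<phi> q
      unfolding torsion_endo_def F.tc_def[symmetric]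
      by (rule cl3_act3[OF \<gamma> F.tc_alt[OF that]])
    have third: "dirac_third M LC T \<phi> a q = S.dirac_third_op (\<phi> a) q" if q: "q \<in> cover M a" for \<phi> q
    proof -
      have "spin_connection M LC (frame M a l) \<phi> a q =
          S.nab l (\<phi> a) q - (1 / 4) *\<^sub>R S.act2 (\<lambda>i j. F.tc l i j q) (\<phi> a q)" for l
      proof -
        have "cl2 (gam M) (\<lambda>i j. F.\<Gamma> l i j q) *v \<phi> a q = S.act2 (\<lambda>i j. F.\<Gamma> l i j q) (\<phi> a q)"
          by (rule cl2_act2[OF \<gamma> F.\<Gamma>_skew[OF q]])
        moreover have "S.act2 (\<lambda>i j. F.\<omega> l i j q) x =
            S.act2 (\<lambda>i j. F.\<Gamma> l i j q) x + (1 / 2) *\<^sub>R S.act2 (\<lambda>i j. F.tc l i j q) x" for x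
          unfolding F.\<omega>_def by (simp only: S.act2_add S.act2_scale)
        ultimately show ?thesis
          by (simp add: spin_connection_def S.nab_def F.vd_def vec_deriv_basis F.\<Gamma>_def scaleR_add_right)
      qed
      \<comment> \<open>The Clifford contraction of \<open>\<onequarter> e\<^sub>l \<rfloor> T\<close> is \<open>\<threequarters> T\<close>.\<close>
      then have "dirac M LC \<phi> a q = S.dirac_op (\<phi> a) q - (3 / 4) *\<^sub>R S.tor q (\<phi> a q)"
        by (simp add: dirac_def S.dirac_op_def S.G_linear_simps sum_subtractf
            S.act3_contraction[of "\<lambda>l i j. F.tc l i j q"] flip: scaleR_right.sum)
      then show ?thesis
        by (simp add: dirac_third_def S.dirac_third_op_def tor[OF q] flip: scaleR_diff_left)
    qed
    have smooth: "F.vsmooth (\<psi> a)"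
      unfolding F.vsmooth_def
    proof (intro ballI)
      fix b :: "complex ^ 's" and q
      assume b: "b \<in> Basis" and q: "q \<in> cover M a"
      from b obtain s u where "b = axis s u" "u \<in> {1, \<i>}"
        by (auto simp: Basis_vec_def Basis_complex_def)
      then show "smooth_at (charts M) q (\<lambda>q. \<psi> a q \<bullet> b)"
        using \<psi> q by (auto simp: spinor_field_def inner_axis inner_complex_def)
    qed
    have Tsmooth: "F.vsmooth (\<lambda>q. S.tor q (\<psi> a q))"
      by (rule S.vsmooth_act3[OF F.smooth_tc smooth])
    \<comment> \<open>The abstract operators only see values on \<open>cover M a\<close>, where the components of \<open>\<phi>\<close> may be replaced.\<close>
    have sq: "dirac_third_sq M LC T \<phi> a p = S.dirac_third_op (S.dirac_third_op \<eta>) p"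
      if "F.vsmooth \<eta>" "\<And>q. q \<in> cover M a \<Longrightarrow> \<eta> q = \<phi> a q" for \<phi> \<eta>
    proof -
      have "S.dirac_third_op \<eta> q = dirac_third M LC T \<phi> a q" if "q \<in> cover M a" for q
        by (simp add: third[OF that] S.dirac_third_op_cong[OF \<open>F.vsmooth \<eta>\<close> \<open>\<And>q. q \<in> cover M a \<Longrightarrow> \<eta> q = \<phi> a q\<close> that])
      then have "S.dirac_third_op (S.dirac_third_op \<eta>) p = S.dirac_third_op (dirac_third M LC T \<phi> a) p"
        by (rule S.dirac_third_op_cong[OF S.vsmooth_dirac_third_op[OF that(1)] _ p])
      then show ?thesis
        by (simp add: dirac_third_sq_def third[OF p])
    qed
    have comm: "dirac_third_sq M LC T (torsion_endo M T \<psi>) a p = S.tor p (dirac_third_sq M LC T \<psi> a p)"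
      using sq[OF Tsmooth, of "torsion_endo M T \<psi>"] sq[OF smooth, of \<psi>]
        S.dirac_third_op_sq_tor[OF smooth p] by (simp add: tor)
    have casimir: "casimir M LC T \<phi> a p = dirac_third_sq M LC T \<phi> a p
        - (1 / 8 * scal M LC a p) *\<^sub>R \<phi> a p - (1 / 16 * form_norm_sq M T a p) *\<^sub>R \<phi> a p" for \<phi>
      unfolding casimir_def sigma_form_def codiff_def F.ext_deriv_eq_sigma[OF p] F.codifferential_zero[OF p]
      by (simp add: cl4_def cl2_def)
    interpret L: linear "S.tor p" by (rule S.linear_act3)
    show ?thesis
      by (simp add: tor[OF p] comm casimir L.diff L.scale)
  qed
  then show ?thesis
    by (simp add: commute_on_spinors_def)
qed

end
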